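(* For every $1\leq p\leq\infty$ and every ordinal $1\leq\xi\leq\omega_1$, the class $\mathcal{WD}_{\ell_p}^{(\infty,\xi)}$ is an operator ideal.
   Context: All Banach spaces are over a fixed scalar field ($\mathbb{R}$ or $\mathbb{C}$); $\mathcal{L}(X,Y)$ is the space of continuous linear operators $X\to Y$; $c_{00}$ is the space of finitely supported scalar sequences; $\omega_1$ is the first uncountable ordinal. For finite $E,F\subset\mathbb{N}$, $E<F$ means $\max E<\min F$, and $n\leq F$ means $n\leq\min F$. Schreier families: $\mathcal{S}_0:=\{\{n\}:n\in\mathbb{N}\}\cup\{\emptyset\}$ and $\mathcal{S}_1:=\{F\subset\mathbb{N}:\#F\leq\min F\}\cup\{\emptyset\}$. If $\xi=\zeta+1$ with $1\leq\zeta<\omega_1$, $\mathcal{S}_\xi$ consists of $\emptyset$ and all $F\subset\mathbb{N}$ for which there are $n\in\mathbb{N}$ and $F_1<\cdots<F_n$ in $\mathcal{S}_\zeta$ with $\{\min F_k\}_{k=1}^n\in\mathcal{S}_1$ and $F=\bigcup_{k=1}^nF_k$. If $\xi<\omega_1$ is a limit ordinal, fix a strictly increasing sequence $(\zeta_n)$ of non-limit ordinals with $\sup_n\zeta_n=\xi$ and set $\mathcal{S}_\xi:=\bigcup_{n=1}^\infty\{F\in\mathcal{S}_{\zeta_n}:n\leq F\}$. Finally $\mathcal{S}_{\omega_1}:=\{F\subset\mathbb{N}:\#F<\infty\}$. For $1\leq\xi\leq\omega_1$ put $\mathcal{A}_\xi:=\{(\alpha_k)\in c_{00}:\mathrm{supp}(\alpha_k)\in\mathcal{S}_\xi\}$.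 For $1\leq p\leq\infty$ and $0\leq C<\infty$, $\mathcal{WD}_{\ell_p}^{(C,\xi)}(X,Y)$ is the set of all $T\in\mathcal{L}(X,Y)$ such that for every $\epsilon>0$, each normalized weakly null sequence $(x_n)\subset X$ admits a subsequence $(x_{n_k})$ with $\|\sum\alpha_kTx_{n_k}\|\leq(C+\epsilon)\|(\alpha_k)\|_{\ell_p}$ for all $(\alpha_k)\in\mathcal{A}_\xi$. Set $\mathcal{WD}_{\ell_p}^{(\infty,\xi)}(X,Y):=\bigcup_{0\leq C<\infty}\mathcal{WD}_{\ell_p}^{(C,\xi)}(X,Y)$; the class $\mathcal{WD}_{\ell_p}^{(\infty,\xi)}$ has these sets as components. Operator ideal: a subclass $\mathcal{J}$ of the class $\mathcal{L}$ of all continuous linear operators between Banach spaces such that, for all Banach spaces $X,Y$, $\mathcal{J}(X,Y):=\mathcal{L}(X,Y)\cap\mathcal{J}$ is a linear subspace containing all finite-rank operators from $X$ into $Y$, and such that $BTA\in\mathcal{J}(W,Z)$ whenever $W,X,Y,Z$ are Banach spaces, $T\in\mathcal{J}(X,Y)$, $A\in\mathcal{L}(W,X)$, $B\in\mathcal{L}(Y,Z)$. *)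

theory Defs
  imports
    "HOL-Analysis.Analysis"
    "HOL-Algebra.Module"
begin

section \<open>Ordinals up to the first uncountable one\<close>

text \<open>
  The type below is the set of all ordinals smaller than the cardinal \<open>\<omega>\<^sub>2\<close>, so every
  ordinal up to and including \<open>\<omega>\<^sub>1\<close> occurs in it.
\<close>

abbreviation (input) omega2_rel :: "nat set set rel"
  where "omega2_rel \<equiv> cardSuc (cardSuc natLeq)"

lemma Card_order_omega1_rel: "Card_order (cardSuc natLeq)"
  by (simp add: cardSuc_Card_order natLeq_Card_order)

lemma Card_order_omega2_rel: "Card_order omega2_rel"
  by (simp add: cardSuc_Card_order Card_order_omega1_rel)

lemma infinite_Field_omega1_rel: "infinite (Field (cardSuc natLeq))"
  using cardSuc_finite[OF natLeq_Card_order] by (simp add: Field_natLeq)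

lemma infinite_Field_omega2_rel: "infinite (Field omega2_rel)"
  using cardSuc_finite[OF Card_order_omega1_rel] infinite_Field_omega1_rel by simp

lemma Well_order_omega2_rel: "Well_order omega2_rel"
  using Card_order_omega2_rel card_order_on_well_order_on by blast

typedef ordinal = "Field omega2_rel"
proof -
  have "Field omega2_rel \<noteq> {}"
    using infinite_Field_omega2_rel by (metis finite.emptyI)
  then show "\<exists>x. x \<in> Field omega2_rel" by blast
qed

instantiation ordinal :: wellorder
begin

definition less_eq_ordinal :: "ordinal \<Rightarrow> ordinal \<Rightarrow> bool"
  where "a \<le> b \<longleftrightarrow> (Rep_ordinal a, Rep_ordinal b) \<in> omega2_rel"

definition less_ordinal :: "ordinal \<Rightarrow> ordinal \<Rightarrow> bool"
  where "a < b \<longleftrightarrow> a \<le> b \<and> a \<noteq> (b :: ordinal)"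

instance
proof -
  have wo: "wo_rel omega2_rel"
    using Well_order_omega2_rel by (simp add: wo_rel_def)
  have antisym: "x = y" if "x \<le> y" "y \<le> x" for x y :: ordinal
    using that antisymD[OF wo_rel.ANTISYM[OF wo]]
    by (metis less_eq_ordinal_def Rep_ordinal_inject)
  have trans: "x \<le> z" if "x \<le> y" "y \<le> z" for x y z :: ordinal
    using that transD[OF wo_rel.TRANS[OF wo]] unfolding less_eq_ordinal_def by blast
  have total: "x \<le> y \<or> y \<le> x" for x y :: ordinal
    using wo_rel.TOTALS[OF wo] Rep_ordinal unfolding less_eq_ordinal_def by blast
  have wf: "wf {(x, y :: ordinal). x < y}"
  proof -
    have "wf (inv_image (omega2_rel - Id) Rep_ordinal)"
      by (intro wf_inv_image wo_rel.WF[OF wo])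
    moreover have "{(x, y :: ordinal). x < y} = inv_image (omega2_rel - Id) Rep_ordinal"
      by (auto simp: less_ordinal_def less_eq_ordinal_def Rep_ordinal_inject)
    ultimately show ?thesis by simp
  qed
  show "OFCLASS(ordinal, wellorder_class)"
  proof
    fix x y z :: ordinal
    show "x < y \<longleftrightarrow> x \<le> y \<and> \<not> y \<le> x"
      unfolding less_ordinal_def using antisym[of x y] total[of x x] by blast
    show "x \<le> x" using total[of x x] by simp
    show "x \<le> z" if "x \<le> y" "y \<le> z" using trans that .
    show "x = y" if "x \<le> y" "y \<le> x" using antisym that .
    show "x \<le> y \<or> y \<le> x" by (rule total)
  next
    fix P :: "ordinal \<Rightarrow> bool" and a
    assume "\<And>x. (\<And>y. y < x \<Longrightarrow> P y) \<Longrightarrow> P x"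
    then show "P a" by (intro wf_induct[OF wf, of P a]) simp
  qed
qed

end

definition osuc :: "ordinal \<Rightarrow> ordinal"
  where "osuc a = (LEAST b. a < b)"

instantiation ordinal :: "{zero, one}"
begin

definition zero_ordinal :: ordinal where "0 = (LEAST a :: ordinal. True)"

definition one_ordinal :: ordinal where "1 = osuc 0"

instance ..

end

definition is_limit :: "ordinal \<Rightarrow> bool"
  where "is_limit a \<longleftrightarrow> a \<noteq> 0 \<and> (\<forall>b. a \<noteq> osuc b)"

definition omega1 :: ordinal
  where "omega1 = (LEAST a. uncountable {..<a})"

lemma zero_le_ordinal [simp]: "0 \<le> (a :: ordinal)"
  unfolding zero_ordinal_def by (rule Least_le) simp

lemma ordinal_no_max: "\<exists>b. (a :: ordinal) < b"
proof -
  have "\<exists>y\<in>Field omega2_rel. Rep_ordinal a \<noteq> y \<and> (Rep_ordinal a, y) \<in> omega2_rel"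
    by (rule infinite_Card_order_limit[OF Card_order_omega2_rel infinite_Field_omega2_rel Rep_ordinal])
  then obtain y where y: "y \<in> Field omega2_rel" "Rep_ordinal a \<noteq> y" "(Rep_ordinal a, y) \<in> omega2_rel"
    by blast
  then have "a < Abs_ordinal y"
    by (auto simp: less_ordinal_def less_eq_ordinal_def Abs_ordinal_inverse)
  then show ?thesis ..
qed

lemma less_osuc [simp]: "a < osuc a"
  unfolding osuc_def using ordinal_no_max[of a] by (rule LeastI_ex)

lemma osuc_le: "a < b \<Longrightarrow> osuc a \<le> b"
  unfolding osuc_def by (rule Least_le)

lemma exists_uncountable_ordinal: "\<exists>a :: ordinal. uncountable {..<a}"
proof -
  include cardinal_syntax
  have wo1: "Well_order (cardSuc natLeq)"
    using Card_order_omega1_rel card_order_on_well_order_on by blast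
  have "cardSuc natLeq <o omega2_rel"
    by (rule cardSuc_greater[OF Card_order_omega1_rel])
  then obtain a where a: "a \<in> Field omega2_rel"
    and iso: "cardSuc natLeq =o Restr omega2_rel (underS omega2_rel a)"
    using ordLess_iff_ordIso_Restr[OF Well_order_omega2_rel wo1] by blast
  obtain f where "BNF_Wellorder_Embedding.iso (cardSuc natLeq) (Restr omega2_rel (underS omega2_rel a)) f"
    using iso by (auto simp: ordIso_def)
  then have inj: "inj_on f (Field (cardSuc natLeq))"
    and img: "f ` Field (cardSuc natLeq) \<subseteq> underS omega2_rel a"
    by (auto simp: BNF_Wellorder_Embedding.iso_def bij_betw_def Field_def)
  have "uncountable (Field (cardSuc natLeq))"
  proof
    assume "countable (Field (cardSuc natLeq))"
    then obtain g :: "nat set \<Rightarrow> nat" where g: "inj_on g (Field (cardSuc natLeq))"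
      by (auto simp: countable_def)
    then have "|Field (cardSuc natLeq)| \<le>o |UNIV :: nat set|"
      by (auto simp: card_of_ordLeq[symmetric])
    moreover have "cardSuc natLeq =o |Field (cardSuc natLeq)|"
      using card_of_Field_ordIso[OF Card_order_omega1_rel] ordIso_symmetric by blast
    moreover have "|UNIV :: nat set| =o natLeq" by (rule card_of_nat)
    ultimately have "cardSuc natLeq \<le>o natLeq"
      using ordIso_ordLeq_trans ordLeq_ordIso_trans by blast
    then show False
      using cardSuc_greater[OF natLeq_Card_order] not_ordLess_ordLeq by blast
  qed
  then have unc: "uncountable (underS omega2_rel a)"
    using inj img by (meson countable_image_inj_on countable_subset)
  have "underS omega2_rel a \<subseteq> Rep_ordinal ` {..<Abs_ordinal a}"
  proof
    fix x assume x: "x \<in> underS omega2_rel a"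
    then have xF: "x \<in> Field omega2_rel" by (auto simp: underS_def Field_def)
    then have "Abs_ordinal x < Abs_ordinal a"
      using x a
      by (auto simp: underS_def less_ordinal_def less_eq_ordinal_def Abs_ordinal_inverse
          Abs_ordinal_inject)
    then show "x \<in> Rep_ordinal ` {..<Abs_ordinal a}"
      by (intro image_eqI[of _ _ "Abs_ordinal x"]) (auto simp: Abs_ordinal_inverse xF)
  qed
  then have "uncountable {..<Abs_ordinal a}"
    using unc by (meson countable_image countable_subset)
  then show ?thesis ..
qed

lemma uncountable_omega1: "uncountable {..<omega1}"
  unfolding omega1_def using exists_uncountable_ordinal by (rule LeastI_ex)

lemma countable_below_omega1: "a < omega1 \<Longrightarrow> countable {..<a}"
  unfolding omega1_def using not_less_Least by blast

lemma osuc_eq_iff [simp]: "osuc a = osuc b \<longleftrightarrow> a = b"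
proof
  assume eq: "osuc a = osuc b"
  have "\<not> a < b"
    using osuc_le[of a b] less_osuc[of b] unfolding eq by (meson leD)
  moreover have "\<not> b < a"
    using osuc_le[of b a] less_osuc[of a] unfolding eq[symmetric] by (meson leD)
  ultimately show "a = b" using linorder_less_linear[of a b] by blast
qed simp

lemma osuc_not_le_0 [simp]: "\<not> osuc a \<le> 0"
  using le_less_trans[OF zero_le_ordinal less_osuc, of a] unfolding linorder_not_le .

lemma osuc_neq_0 [simp]: "osuc a \<noteq> 0" "0 \<noteq> osuc a"
proof -
  show "osuc a \<noteq> 0"
    using osuc_not_le_0[of a] by (rule contrapos_nn) simp
  then show "0 \<noteq> osuc a" by (rule not_sym)
qed

lemma one_neq_0_ordinal [simp]: "(1 :: ordinal) \<noteq> 0" "(0 :: ordinal) \<noteq> 1"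
  by (simp_all add: one_ordinal_def)

lemma is_limit_simps [simp]: "\<not> is_limit 0" "\<not> is_limit 1" "\<not> is_limit (osuc a)"
  by (auto simp: is_limit_def one_ordinal_def)

lemma osuc_less_omega1:
  assumes "a < omega1"
  shows "osuc a < omega1"
proof -
  have "{..<osuc a} \<subseteq> insert a {..<a}"
  proof
    fix b assume "b \<in> {..<osuc a}"
    then have "\<not> a < b" using osuc_le[of a b] leD by blast
    then show "b \<in> insert a {..<a}" using linorder_less_linear[of a b] by blast
  qed
  then have "countable {..<osuc a}"
    using countable_below_omega1[OF assms] by (meson countable_insert countable_subset)
  then have "osuc a \<noteq> omega1"
    using uncountable_omega1 by auto
  then show ?thesis
    using osuc_le[OF assms] le_neq_trans by blast
qed

lemma zero_less_omega1: "0 < omega1"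
proof (rule ccontr)
  assume "\<not> 0 < omega1"
  then have "{..<omega1} = {}"
    using le_less_trans[OF zero_le_ordinal] by blast
  then show False using uncountable_omega1 by simp
qed

lemma one_less_omega1: "1 < omega1"
  using osuc_less_omega1[OF zero_less_omega1] by (simp add: one_ordinal_def)


section \<open>Schreier families\<close>

text \<open>
  Throughout, \<open>\<nat>\<close> is the set \<open>{1..}\<close> of positive integers: index sets are subsets of \<open>{1..}\<close>,
  and the value at \<open>0\<close> of a sequence of type \<open>nat \<Rightarrow> _\<close> is irrelevant.
\<close>

text \<open>
  The sequences \<open>(\<zeta>\<^sub>n)\<close> chosen at the limit ordinals: \<open>z \<xi> n\<close> is the \<open>n\<close>-th member of the
  sequence chosen for \<open>\<xi>\<close>.
\<close>

definition limit_choice :: "(ordinal \<Rightarrow> nat \<Rightarrow> ordinal) \<Rightarrow> bool"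
  where "limit_choice z \<longleftrightarrow>
    (\<forall>\<xi><omega1. is_limit \<xi> \<longrightarrow>
       strict_mono_on {1..} (z \<xi>) \<and>
       (\<forall>n\<ge>1. \<not> is_limit (z \<xi> n)) \<and>
       (\<forall>n\<ge>1. z \<xi> n \<le> \<xi>) \<and> (\<forall>\<eta>. (\<forall>n\<ge>1. z \<xi> n \<le> \<eta>) \<longrightarrow> \<xi> \<le> \<eta>))"

lemma limit_choice_exists: "\<exists>z. limit_choice z"
proof -
  have "\<exists>f :: nat \<Rightarrow> ordinal. strict_mono_on {1..} f \<and> (\<forall>n\<ge>1. \<not> is_limit (f n)) \<and>
      (\<forall>n\<ge>1. f n \<le> \<xi>) \<and> (\<forall>\<eta>. (\<forall>n\<ge>1. f n \<le> \<eta>) \<longrightarrow> \<xi> \<le> \<eta>)"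
    if \<xi>: "\<xi> < omega1" "is_limit \<xi>" for \<xi>
  proof -
    have lim: "osuc b < \<xi>" if "b < \<xi>" for b
      using osuc_le[OF that] \<xi>(2) unfolding is_limit_def by (metis order_le_less)
    have pos: "0 < \<xi>"
      using \<xi>(2) zero_le_ordinal[of \<xi>] unfolding is_limit_def by (metis order_le_less)
    obtain a :: "nat \<Rightarrow> ordinal" where a: "range a = {..<\<xi>}"
      using range_from_nat_into[OF _ countable_below_omega1[OF \<xi>(1)]] pos by blast
    define f where "f = rec_nat (osuc 0) (\<lambda>n b. osuc (max b (a n)))"
    have f0: "f 0 = osuc 0" and fS: "f (Suc n) = osuc (max (f n) (a n))" for n
      by (simp_all add: f_def)
    have less: "f n < \<xi>" for n
    proof (induction n)
      case 0
      then show ?case using lim[OF pos] by (simp add: f0)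
    next
      case (Suc n)
      have "a n < \<xi>" using a by blast
      with Suc have "max (f n) (a n) < \<xi>" by (simp add: max_def)
      then show ?case unfolding fS by (rule lim)
    qed
    have step: "f n < f (Suc n)" "a n < f (Suc n)" for n
      unfolding fS by (rule le_less_trans[OF max.cobounded1 less_osuc],
          rule le_less_trans[OF max.cobounded2 less_osuc])
    have mono: "strict_mono f"
      using step(1) by (simp add: strict_mono_Suc_iff)
    have nonlim: "\<not> is_limit (f n)" for n
      by (cases n) (simp_all add: f0 fS)
    have lub: "\<xi> \<le> \<eta>" if "\<forall>n\<ge>1. f n \<le> \<eta>" for \<eta>
    proof (rule ccontr)
      assume "\<not> \<xi> \<le> \<eta>"
      then have "\<eta> \<in> range a" by (simp add: a linorder_not_le)
      then obtain n where "\<eta> = a n" by blast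
      then have "\<eta> < f (Suc n)" using step(2) by simp
      moreover have "f (Suc n) \<le> \<eta>" using that by simp
      ultimately show False by (metis linorder_not_le)
    qed
    show ?thesis
    proof (rule exI[of _ f], intro conjI allI impI)
      show "strict_mono_on {1..} f"
        by (rule strict_mono_onI) (rule strict_monoD[OF mono])
      show "\<not> is_limit (f n)" for n by (rule nonlim)
      show "f n \<le> \<xi>" for n by (rule less_imp_le[OF less])
      show "\<xi> \<le> \<eta>" if "\<forall>n\<ge>1. f n \<le> \<eta>" for \<eta> using that by (rule lub)
    qed
  qed
  then show ?thesis
    unfolding limit_choice_def by metis
qed

definition schreier1 :: "nat set set"
  where "schreier1 = {F. F \<subseteq> {1..} \<and> finite F \<and> F \<noteq> {} \<and> card F \<le> Min F} \<union> {{}}"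

text \<open>
  The transfinite recursion is written as an inductive definition; its clauses concern
  pairwise different ordinals, so it is equivalent to the equations \<open>schreier_0\<close>, \<open>schreier_1\<close>,
  \<open>schreier_succ\<close>, \<open>schreier_limit\<close> and \<open>schreier_omega1\<close> below.
\<close>

inductive in_schreier :: "(ordinal \<Rightarrow> nat \<Rightarrow> ordinal) \<Rightarrow> ordinal \<Rightarrow> nat set \<Rightarrow> bool"
  for z :: "ordinal \<Rightarrow> nat \<Rightarrow> ordinal" where
  zero: "F \<in> {{n} | n. n \<ge> 1} \<union> {{}} \<Longrightarrow> in_schreier z 0 F"
| one: "F \<in> schreier1 \<Longrightarrow> in_schreier z 1 F"
| succ_empty: "\<lbrakk>1 \<le> \<zeta>; \<zeta> < omega1\<rbrakk> \<Longrightarrow> in_schreier z (osuc \<zeta>) {}"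
| succ: "\<lbrakk>1 \<le> \<zeta>; \<zeta> < omega1; n \<ge> 1;
      \<And>k. k \<in> {1..n} \<Longrightarrow> in_schreier z \<zeta> (G k);
      \<forall>k\<in>{1..n}. G k \<noteq> {};
      \<forall>k\<in>{1..<n}. Max (G k) < Min (G (Suc k));
      (\<lambda>k. Min (G k)) ` {1..n} \<in> schreier1;
      F = (\<Union>k\<in>{1..n}. G k)\<rbrakk>
    \<Longrightarrow> in_schreier z (osuc \<zeta>) F"
| limit: "\<lbrakk>is_limit \<xi>; \<xi> < omega1; n \<ge> 1; in_schreier z (z \<xi> n) F; F = {} \<or> n \<le> Min F\<rbrakk>
    \<Longrightarrow> in_schreier z \<xi> F"
| omega1: "\<lbrakk>F \<subseteq> {1..}; finite F\<rbrakk> \<Longrightarrow> in_schreier z omega1 F"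

definition schreier :: "(ordinal \<Rightarrow> nat \<Rightarrow> ordinal) \<Rightarrow> ordinal \<Rightarrow> nat set set"
  where "schreier z \<xi> = {F. in_schreier z \<xi> F}"

lemma schreier_0: "schreier z 0 = {{n} | n. n \<ge> 1} \<union> {{}}"
    (is "_ = ?R")
proof -
  have *: "F \<in> ?R" if "in_schreier z 0 F" for F
    using that
  proof cases
    case one
    from one_neq_0_ordinal(2) one(1) show ?thesis by (rule notE)
  next
    case (succ_empty \<zeta>)
    from osuc_neq_0(2) succ_empty(1) show ?thesis by (rule notE)
  next
    case (succ \<zeta> n G)
    from osuc_neq_0(2) succ(1) show ?thesis by (rule notE)
  next
    case (limit n)
    from is_limit_simps(1) limit(1) show ?thesis by (rule notE)
  next
    case omega1
    then show ?thesis using zero_less_omega1 by (metis less_irrefl)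
  qed
  show ?thesis
    unfolding schreier_def
    by (intro subset_antisym subsetI CollectI)
      (erule CollectE, erule *, erule in_schreier.zero)
qed

lemma schreier_1: "schreier z 1 = schreier1"
proof -
  have neq: "1 \<noteq> osuc \<zeta>" if "1 \<le> \<zeta>" for \<zeta>
    using that less_osuc[of \<zeta>] by (metis linorder_not_le)
  have *: "F \<in> schreier1" if "in_schreier z 1 F" for F
    using that
  proof cases
    case zero
    from one_neq_0_ordinal(1) zero(1) show ?thesis by (rule notE)
  next
    case (succ_empty \<zeta>)
    from neq[OF succ_empty(3)] succ_empty(1) show ?thesis by (rule notE)
  next
    case (succ \<zeta> n G)
    from neq[OF succ(2)] succ(1) show ?thesis by (rule notE)
  next
    case (limit n)
    from is_limit_simps(2) limit(1) show ?thesis by (rule notE)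
  next
    case omega1
    then show ?thesis using one_less_omega1 by (metis less_irrefl)
  qed
  show ?thesis
    unfolding schreier_def
    by (intro subset_antisym subsetI CollectI)
      (erule CollectE, erule *, erule in_schreier.one)
qed

lemma schreier_succ:
  assumes "1 \<le> \<zeta>" "\<zeta> < omega1"
  shows "schreier z (osuc \<zeta>) = {{}} \<union>
    {\<Union>k\<in>{1..n}. G k | n G. n \<ge> 1 \<and>
       (\<forall>k\<in>{1..n}. G k \<in> schreier z \<zeta> \<and> G k \<noteq> {}) \<and>
       (\<forall>k\<in>{1..<n}. Max (G k) < Min (G (Suc k))) \<and>
       (\<lambda>k. Min (G k)) ` {1..n} \<in> schreier1}"
    (is "_ = ?R")
proof -
  have "\<zeta> \<noteq> 0" using assms(1) by (auto simp: one_ordinal_def)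
  have *: "F \<in> ?R" if "in_schreier z (osuc \<zeta>) F" for F
    using that
  proof cases
    case one
    then show ?thesis using \<open>\<zeta> \<noteq> 0\<close> by (simp add: one_ordinal_def)
  next
    case (succ \<zeta>' n G)
    then have "\<zeta>' = \<zeta>" by simp
    with succ show ?thesis
      by (intro UnI2 CollectI exI[of _ n] exI[of _ G]) (auto simp: schreier_def)
  next
    case omega1
    then show ?thesis using osuc_less_omega1[OF assms(2)] by simp
  qed auto
  have **: "in_schreier z (osuc \<zeta>) F" if F: "F \<in> ?R" for F
  proof (cases "F = {}")
    case True
    then show ?thesis using in_schreier.succ_empty[OF assms] by simp
  next
    case False
    then obtain n G where "F = (\<Union>k\<in>{1..n}. G k)" "n \<ge> 1"
      "\<forall>k\<in>{1..n}. G k \<in> schreier z \<zeta> \<and> G k \<noteq> {}"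
      "\<forall>k\<in>{1..<n}. Max (G k) < Min (G (Suc k))"
      "(\<lambda>k. Min (G k)) ` {1..n} \<in> schreier1"
      using F by blast
    then show ?thesis
      by (intro in_schreier.succ[OF assms, of n z G F]) (auto simp only: schreier_def mem_Collect_eq)
  qed
  show ?thesis
    unfolding schreier_def[of z "osuc \<zeta>"]
    by (intro subset_antisym subsetI CollectI) (erule CollectE, erule *, erule **)
qed

lemma schreier_limit:
  assumes "is_limit \<xi>" "\<xi> < omega1"
  shows "schreier z \<xi> = (\<Union>n\<in>{1..}. {F \<in> schreier z (z \<xi> n). F = {} \<or> n \<le> Min F})"
    (is "_ = ?R")
proof -
  have *: "F \<in> ?R" if "in_schreier z \<xi> F" for F
    using that assms by cases (auto simp: schreier_def)
  have **: "in_schreier z \<xi> F" if "F \<in> ?R" for F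
    using that in_schreier.limit[OF assms] by (auto simp: schreier_def)
  show ?thesis
    unfolding schreier_def[of z \<xi>]
    by (intro subset_antisym subsetI CollectI) (erule CollectE, erule *, erule **)
qed

lemma schreier_omega1: "schreier z omega1 = {F. F \<subseteq> {1..} \<and> finite F}"
proof -
  have neq: "omega1 \<noteq> osuc \<zeta>" if "\<zeta> < omega1" for \<zeta>
    using osuc_less_omega1[OF that] by (metis less_irrefl)
  have *: "F \<subseteq> {1..} \<and> finite F" if "in_schreier z omega1 F" for F
    using that
  proof cases
    case zero
    then show ?thesis using zero_less_omega1 by (metis less_irrefl)
  next
    case one
    then show ?thesis using one_less_omega1 by (metis less_irrefl)
  next
    case (succ_empty \<zeta>)
    from neq[OF succ_empty(4)] succ_empty(1) show ?thesis by (rule notE)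
  next
    case (succ \<zeta> n G)
    from neq[OF succ(3)] succ(1) show ?thesis by (rule notE)
  next
    case (limit n)
    from limit(2) show ?thesis by (rule less_irrefl[THEN notE])
  next
    case omega1
    then show ?thesis ..
  qed
  show ?thesis
    unfolding schreier_def
    by (intro subset_antisym subsetI CollectI; elim CollectE conjE)
      (erule *, erule (1) in_schreier.omega1)
qed


section \<open>Banach spaces and continuous linear operators\<close>

text \<open>
  A Banach space is a record with an explicit carrier set, so that statements can quantify
  over all Banach spaces whose elements are taken from a given type \<open>'a\<close>; as \<open>'a\<close> is
  arbitrary, any finitely many Banach spaces are covered simultaneously.
  The scalar field is a type \<open>'k\<close> of class \<open>real_normed_field\<close> and \<open>banach\<close>. By the
  Gelfand--Mazur theorem, such a field is isometrically isomorphic to the real or the complex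
  numbers, and both are instances.
\<close>

record ('k, 'a) normed_space = "('k, 'a) module" +
  vnorm :: "'a \<Rightarrow> real"

text \<open>The scalar field, both as a ring and as a normed space over itself.\<close>

definition scalar_space :: "('k :: {real_normed_field, banach}, 'k) normed_space"
  where "scalar_space =
    \<lparr>carrier = UNIV, mult = (*), one = 1, zero = 0, add = (+), smult = (*), vnorm = norm\<rparr>"

text \<open>Set to \<open>0\<close> off the carrier to match the library's notion of a metric.\<close>

definition norm_dist :: "('k, 'a) normed_space \<Rightarrow> 'a \<Rightarrow> 'a \<Rightarrow> real"
  where "norm_dist X x y =
    (if x \<in> carrier X \<and> y \<in> carrier X then vnorm X (x \<ominus>\<^bsub>X\<^esub> y) else 0)"

definition norm_topology :: "('k, 'a) normed_space \<Rightarrow> 'a topology"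
  where "norm_topology X = Metric_space.mtopology (carrier X) (norm_dist X)"

locale banach_space =
  module "scalar_space :: ('k, 'k) normed_space" X
  for X :: "('k :: {real_normed_field, banach}, 'a) normed_space" (structure) +
  assumes vnorm_nonneg: "x \<in> carrier X \<Longrightarrow> 0 \<le> vnorm X x"
    and vnorm_eq_0_iff: "x \<in> carrier X \<Longrightarrow> vnorm X x = 0 \<longleftrightarrow> x = \<zero>"
    and vnorm_smult: "x \<in> carrier X \<Longrightarrow> vnorm X (c \<odot> x) = norm c * vnorm X x"
    and vnorm_triangle:
      "\<lbrakk>x \<in> carrier X; y \<in> carrier X\<rbrakk> \<Longrightarrow> vnorm X (x \<oplus> y) \<le> vnorm X x + vnorm X y"
    and complete: "Metric_space.mcomplete (carrier X) (norm_dist X)"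

lemma banach_space_scalar_space:
  "banach_space (scalar_space :: ('k :: {real_normed_field, banach}, 'k) normed_space)"
proof -
  let ?K = "scalar_space :: ('k, 'k) normed_space"
  have "\<exists>y. x + y = 0" for x :: 'k
    using add.right_inverse by blast
  then have K: "cring ?K"
    unfolding scalar_space_def using add.right_inverse
    by unfold_locales (auto simp: algebra_simps Units_def)
  then interpret K: cring ?K .
  have mod: "module ?K ?K"
    by (rule moduleI[OF K K.abelian_group_axioms]) (simp_all add: scalar_space_def algebra_simps)
  have inv: "\<ominus>\<^bsub>?K\<^esub> y = - y" for y :: 'k
    by (rule K.minus_equality) (simp_all add: scalar_space_def)
  have "norm_dist ?K = dist"
    by (intro ext) (simp add: norm_dist_def a_minus_def inv dist_norm, simp add: scalar_space_def)
  then have "Metric_space.mcomplete (carrier ?K) (norm_dist ?K)"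
    using complete_UNIV[where 'a = 'k] by (simp add: scalar_space_def mcomplete_iff_complete)
  then show ?thesis
    by (intro banach_space.intro mod banach_space_axioms.intro)
      (simp_all add: scalar_space_def norm_mult norm_triangle_ineq)
qed

text \<open>
  Operators are extensional functions (equal to \<open>undefined\<close> off the domain), so that equality
  of operators is equality of functions on the domain.
\<close>

definition operators ::
  "('k, 'a) normed_space \<Rightarrow> ('k, 'b) normed_space \<Rightarrow> ('a \<Rightarrow> 'b) set"
  where "operators X Y =
    {T \<in> carrier X \<rightarrow>\<^sub>E carrier Y.
       (\<forall>x\<in>carrier X. \<forall>y\<in>carrier X. T (x \<oplus>\<^bsub>X\<^esub> y) = T x \<oplus>\<^bsub>Y\<^esub> T y) \<and>
       (\<forall>c. \<forall>x\<in>carrier X. T (c \<odot>\<^bsub>X\<^esub> x) = c \<odot>\<^bsub>Y\<^esub> T x) \<and>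
       continuous_map (norm_topology X) (norm_topology Y) T}"

definition finite_rank ::
  "('k, 'a) normed_space \<Rightarrow> ('k, 'b) normed_space \<Rightarrow> ('a \<Rightarrow> 'b) \<Rightarrow> bool"
  where "finite_rank X Y T \<longleftrightarrow>
    T \<in> operators X Y \<and>
    (\<exists>B. finite B \<and> B \<subseteq> carrier Y \<and>
       (\<forall>x\<in>carrier X. \<exists>c. T x = (\<Oplus>\<^bsub>Y\<^esub>b\<in>B. c b \<odot>\<^bsub>Y\<^esub> b)))"

text \<open>A class of operators is given by its components \<open>J X Y\<close>.\<close>

definition operator_ideal ::
  "(('k :: {real_normed_field, banach}, 'a) normed_space \<Rightarrow>
    ('k, 'a) normed_space \<Rightarrow> ('a \<Rightarrow> 'a) set) \<Rightarrow> bool"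
  where "operator_ideal J \<longleftrightarrow>
    (\<forall>X Y. banach_space X \<and> banach_space Y \<longrightarrow>
       J X Y \<subseteq> operators X Y \<and>
       (\<lambda>x\<in>carrier X. \<zero>\<^bsub>Y\<^esub>) \<in> J X Y \<and>
       (\<forall>S\<in>J X Y. \<forall>T\<in>J X Y. (\<lambda>x\<in>carrier X. S x \<oplus>\<^bsub>Y\<^esub> T x) \<in> J X Y) \<and>
       (\<forall>c. \<forall>T\<in>J X Y. (\<lambda>x\<in>carrier X. c \<odot>\<^bsub>Y\<^esub> T x) \<in> J X Y) \<and>
       (\<forall>T. finite_rank X Y T \<longrightarrow> T \<in> J X Y)) \<and>
    (\<forall>W X Y Z. banach_space W \<and> banach_space X \<and> banach_space Y \<and> banach_space Z \<longrightarrow>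
       (\<forall>T\<in>J X Y. \<forall>A\<in>operators W X. \<forall>B\<in>operators Y Z.
          (\<lambda>w\<in>carrier W. B (T (A w))) \<in> J W Z))"


section \<open>The classes of operators\<close>

definition supp :: "(nat \<Rightarrow> 'k :: zero) \<Rightarrow> nat set"
  where "supp \<alpha> = {k. \<alpha> k \<noteq> 0}"

definition schreier_coeffs ::
  "(ordinal \<Rightarrow> nat \<Rightarrow> ordinal) \<Rightarrow> ordinal \<Rightarrow> (nat \<Rightarrow> 'k :: zero) set"
  where "schreier_coeffs z \<xi> = {\<alpha>. finite (supp \<alpha>) \<and> supp \<alpha> \<in> schreier z \<xi>}"

text \<open>The \<open>\<ell>\<^sub>p\<close>-norm of a finitely supported sequence.\<close>

definition lp_norm :: "ereal \<Rightarrow> (nat \<Rightarrow> 'k :: real_normed_field) \<Rightarrow> real"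
  where "lp_norm p \<alpha> =
    (if p = \<infinity> then (SUP k. norm (\<alpha> k))
     else (\<Sum>k\<in>supp \<alpha>. norm (\<alpha> k) powr real_of_ereal p) powr (1 / real_of_ereal p))"

definition weakly_null ::
  "('k :: {real_normed_field, banach}, 'a) normed_space \<Rightarrow> (nat \<Rightarrow> 'a) \<Rightarrow> bool"
  where "weakly_null X x \<longleftrightarrow>
    (\<forall>n\<ge>1. x n \<in> carrier X) \<and> (\<forall>f\<in>operators X scalar_space. (\<lambda>n. f (x n)) \<longlonglongrightarrow> 0)"

definition normalized :: "('k, 'a) normed_space \<Rightarrow> (nat \<Rightarrow> 'a) \<Rightarrow> bool"
  where "normalized X x \<longleftrightarrow> (\<forall>n\<ge>1. x n \<in> carrier X \<and> vnorm X (x n) = 1)"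

text \<open>Here \<open>strict_mono r\<close> implies \<open>r k \<ge> k\<close>, hence \<open>r\<close> maps \<open>{1..}\<close> to itself.\<close>

definition WD ::
  "(ordinal \<Rightarrow> nat \<Rightarrow> ordinal) \<Rightarrow> ereal \<Rightarrow> real \<Rightarrow> ordinal \<Rightarrow>
   ('k :: {real_normed_field, banach}, 'a) normed_space \<Rightarrow> ('k, 'b) normed_space \<Rightarrow>
   ('a \<Rightarrow> 'b) set"
  where "WD z p C \<xi> X Y =
    {T \<in> operators X Y.
       \<forall>\<epsilon>>0. \<forall>x. normalized X x \<and> weakly_null X x \<longrightarrow>
         (\<exists>r :: nat \<Rightarrow> nat. strict_mono r \<and>
            (\<forall>\<alpha>\<in>schreier_coeffs z \<xi>.
               vnorm Y (\<Oplus>\<^bsub>Y\<^esub>k\<in>supp \<alpha>. \<alpha> k \<odot>\<^bsub>Y\<^esub> T (x (r k))) \<le> (C + \<epsilon>) * lp_norm p \<alpha>))}"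

definition WD_infinity ::
  "(ordinal \<Rightarrow> nat \<Rightarrow> ordinal) \<Rightarrow> ereal \<Rightarrow> ordinal \<Rightarrow>
   ('k :: {real_normed_field, banach}, 'a) normed_space \<Rightarrow> ('k, 'b) normed_space \<Rightarrow>
   ('a \<Rightarrow> 'b) set"
  where "WD_infinity z p \<xi> X Y = (\<Union>C\<in>{0..}. WD z p C \<xi> X Y)"

end

theory Submission
  imports Defs
begin

text \<open>
  The class is easiest to handle through the sequences \<open>y\<close> that are \<open>\<xi>\<close>-Schreier dominated by
  \<open>\<ell>\<^sub>p\<close> with a constant \<open>C\<close> (\<open>lp_dominated\<close>): an operator \<open>T\<close> belongs to it iff one constant
  \<open>C\<close> works for all normalized weakly null sequences \<open>x\<close>, in the sense that \<open>T x\<close> has a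
  \<open>C\<close>-dominated subsequence (\<open>WD_infinity_iff\<close>). The arbitrary \<open>\<epsilon>\<close> disappears because it can be
  absorbed into \<open>C\<close>. Each ideal axiom then reduces to a property of dominated sequences.

  \<^emph>\<open>Sums.\<close> A subsequence good for \<open>S\<close> is refined to one good for \<open>T\<close>. It remains good for \<open>S\<close>
  because Schreier families are spreading: moving the elements of a member to the right gives
  another member (\<open>in_schreier_spreading\<close>), so that domination passes to subsequences
  (\<open>lp_dominated_subsequence\<close>).

  \<^emph>\<open>Finite rank.\<close> A finite rank operator maps weakly null sequences to norm null ones
  (\<open>finite_rank_weakly_null\<close>), and a sequence with norms below \<open>(1 / 2) ^ k\<close> is dominated because every
  coefficient is bounded by the \<open>\<ell>\<^sub>p\<close>-norm (\<open>lp_dominated_summable\<close>). Norm convergence rests on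
  the continuity of coordinate functionals, that is, on finitely generated subspaces being closed.
  As the scalar field is only known to be a complete normed field, closedness is derived
  from completeness, adding one vector at a time, and not from local compactness.

  \<^emph>\<open>Composition.\<close> Composing on the left with \<open>B\<close> only multiplies the constant by a bound of \<open>B\<close>.
  On the right, \<open>A w\<close> is weakly null when \<open>w\<close> is, but no longer normalized. If its norms have
  \<open>0\<close> as a cluster point, then some subsequence of \<open>T (A w)\<close> is summable in norm, hence
  dominated. Otherwise the norms are eventually bounded away from \<open>0\<close>; the normalized
  sequence is again weakly null, and the norms, which are bounded by that of \<open>A\<close>, are moved into
  the coefficients without changing their supports (\<open>WD_infinity_compose_right\<close>).
\<close>

section \<open>Schreier families are spreading\<close>

lemma schreier1_spreading:
  assumes "strict_mono r" "F \<in> schreier1"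
  shows "r ` F \<in> schreier1"
proof (cases "F = {}")
  case True
  then show ?thesis by (simp add: schreier1_def)
next
  case False
  with assms(2) have F: "F \<subseteq> {1..}" "finite F" "card F \<le> Min F"
    by (auto simp: schreier1_def)
  have "card (r ` F) = card F"
    using assms(1) by (simp add: card_image strict_mono_on_imp_inj_on strict_mono_imp_inj_on inj_on_subset)
  also have "\<dots> \<le> r (Min F)"
    using F(3) strict_mono_imp_increasing[OF assms(1), of "Min F"] by linarith
  also have "\<dots> = Min (r ` F)"
    using F False by (simp add: mono_Min_commute strict_mono_mono[OF assms(1)])
  finally have "card (r ` F) \<le> Min (r ` F)" .
  moreover have "1 \<le> r n" if "n \<in> F" for n
    using that F(1) strict_mono_imp_increasing[OF assms(1), of n] by fastforce
  ultimately show ?thesis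
    using F False by (auto simp: schreier1_def)
qed

lemma in_schreier_finite:
  assumes "in_schreier z \<xi> F"
  shows "F \<subseteq> {1..} \<and> finite F"
  using assms by induction (auto simp: schreier1_def)

text \<open>
  Since \<open>r\<close> is increasing, it commutes with \<open>Min\<close> and \<open>Max\<close>, so every decomposition of \<open>F\<close> is
  carried to one of \<open>r ` F\<close>; since \<open>k \<le> r k\<close>, the lower bounds on minima are kept.
\<close>

lemma in_schreier_spreading:
  assumes r: "strict_mono r" and "in_schreier z \<xi> F"
  shows "in_schreier z \<xi> (r ` F)"
  using assms(2)
proof induction
  case (zero F)
  have "1 \<le> r n" if "1 \<le> n" for n
    using that strict_mono_imp_increasing[OF r, of n] by linarith
  with zero show ?case
    by (intro in_schreier.zero) auto
next
  case (one F)
  then show ?case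
    by (intro in_schreier.one schreier1_spreading[OF r])
next
  case (succ_empty \<zeta>)
  then show ?case by (simp add: in_schreier.succ_empty)
next
  case (succ \<zeta> n G F)
  have fin: "finite (G k)" "G k \<noteq> {}" if "k \<in> {1..n}" for k
    using in_schreier_finite[OF succ.hyps(4)[OF that]] succ.hyps(5) that by auto
  have Min: "Min (r ` G k) = r (Min (G k))" and Max: "Max (r ` G k) = r (Max (G k))"
    if "k \<in> {1..n}" for k
    using fin[OF that] by (simp_all add: mono_Min_commute mono_Max_commute strict_mono_mono[OF r])
  show ?case
  proof (rule in_schreier.succ[where G = "\<lambda>k. r ` G k", OF succ.hyps(1-3) succ.IH])
    show "\<forall>k\<in>{1..n}. r ` G k \<noteq> {}"
      using succ.hyps(5) by simp
    show "\<forall>k\<in>{1..<n}. Max (r ` G k) < Min (r ` G (Suc k))"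
      using succ.hyps(6) by (simp add: Min Max strict_monoD[OF r])
    have "(\<lambda>k. Min (r ` G k)) ` {1..n} = r ` (\<lambda>k. Min (G k)) ` {1..n}"
      by (simp add: image_image Min cong: image_cong_simp)
    then show "(\<lambda>k. Min (r ` G k)) ` {1..n} \<in> schreier1"
      using schreier1_spreading[OF r succ.hyps(7)] by simp
  qed (use succ.hyps(8) in auto)
next
  case (limit \<xi> n F)
  have "n \<le> Min (r ` F)" if "F \<noteq> {}"
  proof -
    have "n \<le> Min F"
      using limit.hyps(5) that by blast
    also have "\<dots> \<le> r (Min F)"
      by (rule strict_mono_imp_increasing[OF r])
    finally show ?thesis
      using that in_schreier_finite[OF limit.hyps(4)]
      by (simp add: mono_Min_commute strict_mono_mono[OF r])
  qed
  then show ?case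
    by (intro in_schreier.limit[OF limit.hyps(1-3) limit.IH]) blast
next
  case (omega1 F)
  have "1 \<le> r n" if "1 \<le> n" for n
    using that strict_mono_imp_increasing[OF r, of n] by linarith
  with omega1 show ?case
    by (intro in_schreier.omega1) auto
qed

section \<open>Comparison of \<open>\<ell>\<^sub>p\<close>-norms\<close>

lemma norm_le_SUP_norm:
  fixes \<alpha> :: "nat \<Rightarrow> 'k :: real_normed_vector"
  assumes "finite (supp \<alpha>)"
  shows "norm (\<alpha> k) \<le> (SUP k. norm (\<alpha> k))"
proof (rule cSUP_upper)
  have "range (\<lambda>k. norm (\<alpha> k)) \<subseteq> insert 0 ((\<lambda>k. norm (\<alpha> k)) ` supp \<alpha>)"
    by (auto simp: supp_def)
  then show "bdd_above (range (\<lambda>k. norm (\<alpha> k)))"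
    using assms by (meson bdd_above_finite bdd_above_mono finite_imageI finite_insert)
qed simp

lemma norm_le_lp_norm:
  assumes p: "1 \<le> p" and fin: "finite (supp \<alpha>)"
  shows "norm (\<alpha> k) \<le> lp_norm p \<alpha>"
proof (cases "p = \<infinity>")
  case True
  then show ?thesis using norm_le_SUP_norm[OF fin] by (simp add: lp_norm_def)
next
  case False
  define q where "q = real_of_ereal p"
  have q: "1 \<le> q"
    using p False unfolding q_def by (cases p) (auto simp: one_ereal_def)
  show ?thesis
  proof (cases "k \<in> supp \<alpha>")
    case True
    have "norm (\<alpha> k) = (norm (\<alpha> k) powr q) powr (1 / q)"
      using q by (simp add: powr_powr)
    also have "\<dots> \<le> (\<Sum>k\<in>supp \<alpha>. norm (\<alpha> k) powr q) powr (1 / q)"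
      using q True fin by (intro powr_mono2 member_le_sum) auto
    finally show ?thesis using False by (simp add: lp_norm_def q_def)
  next
    case k: False
    then show ?thesis using False by (simp add: lp_norm_def supp_def)
  qed
qed

lemma lp_norm_nonneg: "1 \<le> p \<Longrightarrow> finite (supp \<alpha>) \<Longrightarrow> 0 \<le> lp_norm p \<alpha>"
  using norm_le_lp_norm norm_ge_zero by (rule order_trans[rotated])

text \<open>
  Both changes of coefficients needed below are instances: reindexing along a subsequence
  (\<open>M = 1\<close>, with \<open>h\<close> a left inverse of it) and multiplication by bounded scalars (\<open>h = id\<close>).
\<close>

lemma lp_norm_le_of_inj:
  fixes \<alpha> \<beta> :: "nat \<Rightarrow> 'k :: real_normed_field"
  assumes p: "1 \<le> p" and fin: "finite (supp \<alpha>)" and M: "0 \<le> M"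
    and h: "inj_on h (supp \<beta>)" "h ` supp \<beta> \<subseteq> supp \<alpha>"
    and le: "\<And>k. k \<in> supp \<beta> \<Longrightarrow> norm (\<beta> k) \<le> M * norm (\<alpha> (h k))"
  shows "lp_norm p \<beta> \<le> M * lp_norm p \<alpha>"
proof (cases "p = \<infinity>")
  case True
  have "norm (\<beta> k) \<le> M * lp_norm p \<alpha>" for k
  proof (cases "k \<in> supp \<beta>")
    case True
    have "norm (\<beta> k) \<le> M * norm (\<alpha> (h k))" by (rule le[OF True])
    also have "\<dots> \<le> M * lp_norm p \<alpha>"
      by (intro mult_left_mono norm_le_lp_norm p fin M)
    finally show ?thesis .
  next
    case False
    then show ?thesis
      using M lp_norm_nonneg[OF p fin] by (simp add: supp_def)
  qed
  then show ?thesis using True unfolding lp_norm_def[of p \<beta>] by (simp add: cSUP_least)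
next
  case False
  define q where "q = real_of_ereal p"
  have q: "1 \<le> q"
    using p False unfolding q_def by (cases p) (auto simp: one_ereal_def)
  have "(\<Sum>k\<in>supp \<beta>. norm (\<beta> k) powr q) \<le> (\<Sum>k\<in>supp \<beta>. M powr q * norm (\<alpha> (h k)) powr q)"
  proof (rule sum_mono)
    fix k assume "k \<in> supp \<beta>"
    from le[OF this] have "norm (\<beta> k) powr q \<le> (M * norm (\<alpha> (h k))) powr q"
      using q by (intro powr_mono2) auto
    then show "norm (\<beta> k) powr q \<le> M powr q * norm (\<alpha> (h k)) powr q"
      using M by (simp add: powr_mult)
  qed
  also have "\<dots> = M powr q * (\<Sum>j\<in>h ` supp \<beta>. norm (\<alpha> j) powr q)"
    by (simp add: sum.reindex[OF h(1)] sum_distrib_left)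
  also have "\<dots> \<le> M powr q * (\<Sum>j\<in>supp \<alpha>. norm (\<alpha> j) powr q)"
    by (intro mult_left_mono sum_mono2 fin h(2)) auto
  finally have "(\<Sum>k\<in>supp \<beta>. norm (\<beta> k) powr q) powr (1 / q)
      \<le> (M powr q * (\<Sum>j\<in>supp \<alpha>. norm (\<alpha> j) powr q)) powr (1 / q)"
    using q by (intro powr_mono2) (auto intro: sum_nonneg)
  also have "\<dots> = M * (\<Sum>j\<in>supp \<alpha>. norm (\<alpha> j) powr q) powr (1 / q)"
    using q M by (simp add: powr_mult sum_nonneg powr_powr)
  finally show ?thesis using False by (simp add: lp_norm_def q_def)
qed

section \<open>Normed spaces and bounded operators\<close>

lemma scalar_space_simps [simp]:
  "carrier scalar_space = UNIV" "\<one>\<^bsub>scalar_space\<^esub> = 1" "\<zero>\<^bsub>scalar_space\<^esub> = 0"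
  "c \<otimes>\<^bsub>scalar_space\<^esub> d = c * d" "c \<oplus>\<^bsub>scalar_space\<^esub> d = c + d"
  "c \<odot>\<^bsub>scalar_space\<^esub> d = c * d" "vnorm scalar_space c = norm c"
  by (simp_all add: scalar_space_def)

context banach_space
begin

lemma smult_mem [simp, intro]: "x \<in> carrier X \<Longrightarrow> c \<odot> x \<in> carrier X"
  by (rule smult_closed) simp_all

lemma smult_add_left: "x \<in> carrier X \<Longrightarrow> (c + d) \<odot> x = c \<odot> x \<oplus> d \<odot> x"
  using smult_l_distr[of c d x] by simp

lemma smult_add_right: "x \<in> carrier X \<Longrightarrow> y \<in> carrier X \<Longrightarrow> c \<odot> (x \<oplus> y) = c \<odot> x \<oplus> c \<odot> y"
  by (rule smult_r_distr) simp_all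

lemma smult_smult [simp]: "x \<in> carrier X \<Longrightarrow> c \<odot> (d \<odot> x) = (c * d) \<odot> x"
  using smult_assoc1[of c d x] by simp

lemma one_smult [simp]: "x \<in> carrier X \<Longrightarrow> 1 \<odot> x = x"
  using smult_one[of x] by simp

lemma zero_smult [simp]: "x \<in> carrier X \<Longrightarrow> 0 \<odot> x = \<zero>"
  using smult_l_null[of x] by simp

lemma smult_zero [simp]: "c \<odot> \<zero> = \<zero>"
  using smult_r_null[of c] by simp

lemma a_inv_eq_smult: "x \<in> carrier X \<Longrightarrow> \<ominus> x = (-1) \<odot> x"
  using smult_add_left[of x "-1" 1] by (intro M.minus_equality) simp_all

lemma a_minus_eq_smult: "y \<in> carrier X \<Longrightarrow> x \<ominus> y = x \<oplus> (-1) \<odot> y"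
  by (simp add: a_minus_def a_inv_eq_smult)

text \<open>
  The right-nested second form lets the simplifier cancel within sums that have been
  reassociated.
\<close>

lemma add_smult_cancel:
  assumes "x \<in> carrier X" "y \<in> carrier X" "c + d = 0"
  shows "c \<odot> x \<oplus> d \<odot> x = \<zero>" "c \<odot> x \<oplus> (d \<odot> x \<oplus> y) = y"
proof -
  show *: "c \<odot> x \<oplus> d \<odot> x = \<zero>"
    using assms by (simp flip: smult_add_left)
  show "c \<odot> x \<oplus> (d \<odot> x \<oplus> y) = y"
    using assms * by (simp flip: M.a_assoc)
qed

lemma vnorm_zero [simp]: "vnorm X \<zero> = 0"
  by (simp add: vnorm_eq_0_iff)

lemma vnorm_diff_commute:
  assumes "x \<in> carrier X" "y \<in> carrier X"
  shows "vnorm X (x \<ominus> y) = vnorm X (y \<ominus> x)"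
proof -
  have "x \<ominus> y = (-1) \<odot> (y \<ominus> x)"
    using assms by (simp add: a_minus_eq_smult smult_add_right M.a_comm)
  then show ?thesis
    using assms by (simp add: vnorm_smult)
qed

lemma diff_add_diff:
  assumes "x \<in> carrier X" "y \<in> carrier X" "z \<in> carrier X"
  shows "(x \<ominus> y) \<oplus> (y \<ominus> z) = x \<ominus> z"
  using assms by (simp add: a_minus_def M.a_ac M.r_neg1 M.r_neg2)

lemma vnorm_diff_triangle:
  assumes "x \<in> carrier X" "y \<in> carrier X" "z \<in> carrier X"
  shows "vnorm X (x \<ominus> z) \<le> vnorm X (x \<ominus> y) + vnorm X (y \<ominus> z)"
  using vnorm_triangle[of "x \<ominus> y" "y \<ominus> z"] assms by (simp add: diff_add_diff)

lemma vnorm_finsum_le: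
  assumes "finite A" "f \<in> A \<rightarrow> carrier X"
  shows "vnorm X (\<Oplus>i\<in>A. f i) \<le> (\<Sum>i\<in>A. vnorm X (f i))"
  using assms
proof (induction A rule: finite_induct)
  case (insert a A)
  then have "vnorm X (\<Oplus>i\<in>insert a A. f i) = vnorm X (f a \<oplus> (\<Oplus>i\<in>A. f i))"
    by (simp add: M.finsum_insert)
  also have "\<dots> \<le> vnorm X (f a) + vnorm X (\<Oplus>i\<in>A. f i)"
    using insert.prems by (intro vnorm_triangle M.finsum_closed) auto
  finally show ?case using insert by auto
qed simp

lemma minus_eq_zero_iff: "x \<in> carrier X \<Longrightarrow> y \<in> carrier X \<Longrightarrow> x \<ominus> y = \<zero> \<longleftrightarrow> x = y"
  by (metis M.minus_equality M.minus_minus M.r_neg a_minus_def M.a_inv_closed)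

lemma metric: "Metric_space (carrier X) (norm_dist X)"
proof
  show "0 \<le> norm_dist X x y" for x y
    by (simp add: norm_dist_def vnorm_nonneg)
  show "norm_dist X x y = norm_dist X y x" for x y
    by (simp add: norm_dist_def vnorm_diff_commute)
  show "norm_dist X x y = 0 \<longleftrightarrow> x = y" if "x \<in> carrier X" "y \<in> carrier X" for x y
    using that by (simp add: norm_dist_def vnorm_eq_0_iff minus_eq_zero_iff)
  show "norm_dist X x z \<le> norm_dist X x y + norm_dist X y z"
    if "x \<in> carrier X" "y \<in> carrier X" "z \<in> carrier X" for x y z
    using that by (simp add: norm_dist_def vnorm_diff_triangle)
qed

end

lemma operatorsD:
  assumes "T \<in> operators X Y"
  shows "T \<in> extensional (carrier X)"
    and "x \<in> carrier X \<Longrightarrow> T x \<in> carrier Y"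
    and "x \<in> carrier X \<Longrightarrow> y \<in> carrier X \<Longrightarrow> T (x \<oplus>\<^bsub>X\<^esub> y) = T x \<oplus>\<^bsub>Y\<^esub> T y"
    and "x \<in> carrier X \<Longrightarrow> T (c \<odot>\<^bsub>X\<^esub> x) = c \<odot>\<^bsub>Y\<^esub> T x"
  using assms by (auto simp: operators_def PiE_def)

text \<open>
  Continuity at \<open>0\<close> gives a ball of radius \<open>d\<close> that is mapped into the unit ball; rescaling every
  vector to norm \<open>d / 2\<close> yields the bound \<open>2 / d\<close>.
\<close>

lemma operators_bounded:
  assumes "banach_space X" "banach_space Y" and T: "T \<in> operators X Y"
  obtains M where "0 \<le> M" "\<And>x. x \<in> carrier X \<Longrightarrow> vnorm Y (T x) \<le> M * vnorm X x"
proof -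
  interpret X: banach_space X by fact
  interpret Y: banach_space Y by fact
  note T' = operatorsD[OF T]
  have "continuous_map (Metric_space.mtopology (carrier X) (norm_dist X))
      (Metric_space.mtopology (carrier Y) (norm_dist Y)) T"
    using T by (simp add: operators_def norm_topology_def)
  then obtain d where d: "d > 0"
    "\<And>x. x \<in> carrier X \<Longrightarrow> norm_dist X \<zero>\<^bsub>X\<^esub> x < d \<Longrightarrow> norm_dist Y (T \<zero>\<^bsub>X\<^esub>) (T x) < 1"
    unfolding Metric_space.metric_continuous_map[OF X.metric Y.metric]
    by (meson X.M.zero_closed zero_less_one)
  have T0: "T \<zero>\<^bsub>X\<^esub> = \<zero>\<^bsub>Y\<^esub>"
    using T'(4)[of "\<zero>\<^bsub>X\<^esub>" 0] T'(2)[of "\<zero>\<^bsub>X\<^esub>"] by simp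
  have small: "vnorm Y (T x) < 1" if "x \<in> carrier X" "vnorm X x < d" for x
    using d(2)[OF that(1)] that T'(2)[OF that(1)]
    by (simp add: norm_dist_def T0 X.a_minus_eq_smult Y.a_minus_eq_smult X.vnorm_smult Y.vnorm_smult)
  show ?thesis
  proof (rule that[of "2 / d"])
    show "0 \<le> 2 / d" using d(1) by simp
    fix x assume x: "x \<in> carrier X"
    show "vnorm Y (T x) \<le> 2 / d * vnorm X x"
    proof (cases "vnorm X x = 0")
      case True
      then have "x = \<zero>\<^bsub>X\<^esub>" using x X.vnorm_eq_0_iff by blast
      then show ?thesis by (simp add: T0)
    next
      case False
      then have pos: "0 < vnorm X x" using X.vnorm_nonneg[OF x] by simp
      define t where "t = d / (2 * vnorm X x)"
      have t: "0 < t" "t * vnorm X x < d" using pos d(1) by (simp_all add: t_def field_simps)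
      have "vnorm Y (T (of_real t \<odot>\<^bsub>X\<^esub> x)) < 1"
        using x t by (intro small) (simp_all add: X.vnorm_smult)
      then have "t * vnorm Y (T x) < 1"
        using x t T'(2,4)[OF x] by (simp add: Y.vnorm_smult)
      then have "d * vnorm Y (T x) < 2 * vnorm X x" using pos by (simp add: t_def field_simps)
      then show ?thesis using d(1) by (simp add: field_simps)
    qed
  qed
qed

lemma operatorsI:
  assumes "banach_space X" "banach_space Y"
    and ext: "T \<in> extensional (carrier X)"
    and mem: "\<And>x. x \<in> carrier X \<Longrightarrow> T x \<in> carrier Y"
    and add: "\<And>x y. x \<in> carrier X \<Longrightarrow> y \<in> carrier X \<Longrightarrow> T (x \<oplus>\<^bsub>X\<^esub> y) = T x \<oplus>\<^bsub>Y\<^esub> T y"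
    and smult: "\<And>c x. x \<in> carrier X \<Longrightarrow> T (c \<odot>\<^bsub>X\<^esub> x) = c \<odot>\<^bsub>Y\<^esub> T x"
    and le: "\<And>x. x \<in> carrier X \<Longrightarrow> vnorm Y (T x) \<le> M * vnorm X x"
  shows "T \<in> operators X Y"
proof -
  interpret X: banach_space X by fact
  interpret Y: banach_space Y by fact
  have "continuous_map (norm_topology X) (norm_topology Y) T"
    unfolding norm_topology_def Metric_space.metric_continuous_map[OF X.metric Y.metric]
  proof (intro conjI ballI allI impI)
    show "T ` carrier X \<subseteq> carrier Y" using mem by auto
    fix a and e :: real assume a: "a \<in> carrier X" and e: "0 < e"
    show "\<exists>d>0. \<forall>x. x \<in> carrier X \<and> norm_dist X a x < d \<longrightarrow> norm_dist Y (T a) (T x) < e"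
    proof (intro exI[of _ "e / (\<bar>M\<bar> + 1)"] conjI allI impI)
      fix x assume x: "x \<in> carrier X \<and> norm_dist X a x < e / (\<bar>M\<bar> + 1)"
      then have "norm_dist Y (T a) (T x) = vnorm Y (T (a \<ominus>\<^bsub>X\<^esub> x))"
        using a by (simp add: norm_dist_def mem add smult X.a_minus_eq_smult Y.a_minus_eq_smult)
      also have "\<dots> \<le> M * vnorm X (a \<ominus>\<^bsub>X\<^esub> x)"
        using a x by (intro le) simp
      also have "\<dots> \<le> (\<bar>M\<bar> + 1) * vnorm X (a \<ominus>\<^bsub>X\<^esub> x)"
        using a x by (intro mult_right_mono X.vnorm_nonneg) auto
      also have "\<dots> < e"
        using a x by (auto simp: norm_dist_def field_simps)
      finally show "norm_dist Y (T a) (T x) < e" .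
    qed (use e in auto)
  qed
  then show ?thesis
    using assms by (auto simp: operators_def PiE_def)
qed

lemma operators_finsum:
  assumes "banach_space X" "banach_space Y" and T: "T \<in> operators X Y"
    and "finite A" "f \<in> A \<rightarrow> carrier X"
  shows "T (\<Oplus>\<^bsub>X\<^esub>i\<in>A. f i) = (\<Oplus>\<^bsub>Y\<^esub>i\<in>A. T (f i))"
proof -
  interpret X: banach_space X by fact
  interpret Y: banach_space Y by fact
  note T' = operatorsD[OF T]
  from assms(4,5) show ?thesis
  proof (induction A rule: finite_induct)
    case empty
    show ?case
      using T'(4)[of "\<zero>\<^bsub>X\<^esub>" 0] T'(2)[of "\<zero>\<^bsub>X\<^esub>"] by simp
  next
    case (insert a A)
    then show ?case
      by (simp add: T' Pi_def)
  qed
qed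

lemma operators_add:
  assumes "banach_space X" "banach_space Y" and S: "S \<in> operators X Y" and T: "T \<in> operators X Y"
  shows "(\<lambda>x\<in>carrier X. S x \<oplus>\<^bsub>Y\<^esub> T x) \<in> operators X Y"
proof -
  interpret X: banach_space X by fact
  interpret Y: banach_space Y by fact
  note S' = operatorsD[OF S] and T' = operatorsD[OF T]
  obtain M where M: "\<And>x. x \<in> carrier X \<Longrightarrow> vnorm Y (S x) \<le> M * vnorm X x"
    using operators_bounded[OF assms(1,2) S] by blast
  obtain N where N: "\<And>x. x \<in> carrier X \<Longrightarrow> vnorm Y (T x) \<le> N * vnorm X x"
    using operators_bounded[OF assms(1,2) T] by blast
  show ?thesis
  proof (rule operatorsI[OF assms(1,2), where M = "M + N"])
    fix x assume x: "x \<in> carrier X"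
    have "vnorm Y (S x \<oplus>\<^bsub>Y\<^esub> T x) \<le> vnorm Y (S x) + vnorm Y (T x)"
      using x by (intro Y.vnorm_triangle S' T')
    with M[OF x] N[OF x] show "vnorm Y ((\<lambda>x\<in>carrier X. S x \<oplus>\<^bsub>Y\<^esub> T x) x) \<le> (M + N) * vnorm X x"
      using x by (simp add: algebra_simps)
  qed (auto simp: S' T' Y.smult_add_right Y.M.a_ac)
qed

lemma operators_smult:
  assumes "banach_space X" "banach_space Y" and T: "T \<in> operators X Y"
  shows "(\<lambda>x\<in>carrier X. c \<odot>\<^bsub>Y\<^esub> T x) \<in> operators X Y"
proof -
  interpret X: banach_space X by fact
  interpret Y: banach_space Y by fact
  note T' = operatorsD[OF T]
  obtain N where N: "\<And>x. x \<in> carrier X \<Longrightarrow> vnorm Y (T x) \<le> N * vnorm X x"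
    using operators_bounded[OF assms(1,2) T] by blast
  show ?thesis
  proof (rule operatorsI[OF assms(1,2), where M = "norm c * N"])
    fix x assume x: "x \<in> carrier X"
    then show "vnorm Y ((\<lambda>x\<in>carrier X. c \<odot>\<^bsub>Y\<^esub> T x) x) \<le> (norm c * N) * vnorm X x"
      using N[OF x] by (simp add: Y.vnorm_smult T' mult.assoc mult_left_mono)
  qed (auto simp: T' Y.smult_add_right mult.commute)
qed

lemma operators_compose:
  assumes "banach_space X" "banach_space Y" "banach_space Z"
    and A: "A \<in> operators X Y" and T: "T \<in> operators Y Z"
  shows "(\<lambda>x\<in>carrier X. T (A x)) \<in> operators X Z"
proof -
  interpret X: banach_space X by fact
  interpret Y: banach_space Y by fact
  interpret Z: banach_space Z by fact
  note A' = operatorsD[OF A] and T' = operatorsD[OF T]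
  obtain M where M: "\<And>x. x \<in> carrier X \<Longrightarrow> vnorm Y (A x) \<le> M * vnorm X x"
    using operators_bounded[OF assms(1,2) A] by blast
  obtain N where N: "0 \<le> N" "\<And>x. x \<in> carrier Y \<Longrightarrow> vnorm Z (T x) \<le> N * vnorm Y x"
    using operators_bounded[OF assms(2,3) T] by blast
  show ?thesis
  proof (rule operatorsI[OF assms(1,3), where M = "N * M"])
    fix x assume x: "x \<in> carrier X"
    have "vnorm Z (T (A x)) \<le> N * vnorm Y (A x)"
      using x by (intro N A')
    also have "\<dots> \<le> N * (M * vnorm X x)"
      by (intro mult_left_mono M x N)
    finally show "vnorm Z ((\<lambda>x\<in>carrier X. T (A x)) x) \<le> (N * M) * vnorm X x"
      using x by (simp add: mult.assoc)
  qed (auto simp: A' T')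
qed

section \<open>Finitely generated subspaces and finite rank operators\<close>

context banach_space
begin

text \<open>
  Closedness is spelled out as stability under approximation in norm, the only form in which it
  is produced or consumed here.
\<close>

definition closed_subspace :: "'a set \<Rightarrow> bool"
  where "closed_subspace V \<longleftrightarrow> submodule V scalar_space X \<and>
    (\<forall>y\<in>carrier X. (\<forall>e>0. \<exists>v\<in>V. vnorm X (y \<ominus> v) < e) \<longrightarrow> y \<in> V)"

definition add_line :: "'a set \<Rightarrow> 'a \<Rightarrow> 'a set"
  where "add_line V b = {v \<oplus> c \<odot> b | v c. v \<in> V}"

definition finite_span :: "'a set \<Rightarrow> 'a set"
  where "finite_span B = range (\<lambda>c. \<Oplus>b\<in>B. c b \<odot> b)"

lemma closed_subspaceD:
  assumes "closed_subspace V"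
  shows "v \<in> V \<Longrightarrow> v \<in> carrier X"
    and "v \<in> V \<Longrightarrow> w \<in> V \<Longrightarrow> v \<oplus> w \<in> V"
    and "v \<in> V \<Longrightarrow> c \<odot> v \<in> V"
    and "y \<in> carrier X \<Longrightarrow> (\<And>e. 0 < e \<Longrightarrow> \<exists>v\<in>V. vnorm X (y \<ominus> v) < e) \<Longrightarrow> y \<in> V"
    and "\<zero> \<in> V"
proof -
  have V: "submodule V scalar_space X" using assms by (simp add: closed_subspace_def)
  show "v \<in> V \<Longrightarrow> v \<in> carrier X" for v using submoduleE(1)[OF V] by blast
  show "v \<in> V \<Longrightarrow> w \<in> V \<Longrightarrow> v \<oplus> w \<in> V" using submoduleE(5)[OF V] .
  show smult: "v \<in> V \<Longrightarrow> c \<odot> v \<in> V" for c v using submoduleE(4)[OF V] by simp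
  show "y \<in> carrier X \<Longrightarrow> (\<And>e. 0 < e \<Longrightarrow> \<exists>v\<in>V. vnorm X (y \<ominus> v) < e) \<Longrightarrow> y \<in> V"
    using assms by (auto simp: closed_subspace_def)
  obtain v where "v \<in> V" using submoduleE(2)[OF V] by blast
  with smult[of v 0] submoduleE(1)[OF V] show "\<zero> \<in> V" by auto
qed

text \<open>
  A closed subspace has positive distance \<open>d\<close> from a vector \<open>b\<close> outside it; by homogeneity the
  coefficient of \<open>b\<close> in a vector of the enlarged subspace is bounded by \<open>1 / d\<close> times its norm.
\<close>

lemma line_distance:
  assumes V: "closed_subspace V" and b: "b \<in> carrier X" "b \<notin> V"
  obtains d where "0 < d" "\<And>v c. v \<in> V \<Longrightarrow> d * norm c \<le> vnorm X (v \<oplus> c \<odot> b)"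
proof -
  note V' = closed_subspaceD[OF V]
  obtain d where d: "0 < d" "\<And>v. v \<in> V \<Longrightarrow> d \<le> vnorm X (b \<ominus> v)"
    using V'(4)[OF b(1)] b(2) by (meson linorder_not_le)
  have "d * norm c \<le> vnorm X (v \<oplus> c \<odot> b)" if v: "v \<in> V" for v c
  proof (cases "c = 0")
    case True
    then show ?thesis using v b V'(1) by (simp add: vnorm_nonneg)
  next
    case False
    have "v \<oplus> c \<odot> b = c \<odot> (b \<ominus> (- inverse c) \<odot> v)"
      using v b V'(1) False by (simp add: a_minus_eq_smult smult_add_right M.a_comm)
    then have "vnorm X (v \<oplus> c \<odot> b) = norm c * vnorm X (b \<ominus> (- inverse c) \<odot> v)"
      using v b V'(1) by (simp add: vnorm_smult)
    moreover have "norm c * d \<le> norm c * vnorm X (b \<ominus> (- inverse c) \<odot> v)"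
      by (intro mult_left_mono d(2)[OF V'(3)[OF v]] norm_ge_zero)
    ultimately show ?thesis by (simp only: mult.commute)
  qed
  with d(1) show ?thesis by (rule that)
qed

lemma diff_add_line:
  assumes "v \<in> carrier X" "w \<in> carrier X" "b \<in> carrier X"
  shows "(v \<oplus> c \<odot> b) \<ominus> (w \<oplus> d \<odot> b) = (v \<ominus> w) \<oplus> (c - d) \<odot> b"
proof -
  have "(c - d) \<odot> b = c \<odot> b \<oplus> (- d) \<odot> b"
    using assms smult_add_left[of b c "- d"] by simp
  then show ?thesis
    using assms by (simp add: a_minus_eq_smult smult_add_right M.a_ac)
qed

text \<open>
  If \<open>v n \<oplus> c n \<odot> b\<close> converges to \<open>y\<close>, then the coefficients \<open>c n\<close> form a Cauchy sequence by
  \<open>line_distance\<close>. Completeness of the scalar field gives their limit \<open>l\<close>, and then \<open>v n\<close>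
  converges to \<open>y \<ominus> l \<odot> b\<close>, which lies in \<open>V\<close> because \<open>V\<close> is closed.
\<close>

lemma closed_subspace_add_line:
  assumes V: "closed_subspace V" and b: "b \<in> carrier X"
  shows "closed_subspace (add_line V b)"
proof (cases "b \<in> V")
  case True
  note V' = closed_subspaceD[OF V]
  have "add_line V b = V"
  proof
    show "add_line V b \<subseteq> V"
      using True V'(2,3) by (auto simp: add_line_def)
    show "V \<subseteq> add_line V b"
    proof
      fix v assume "v \<in> V"
      moreover from this have "v = v \<oplus> 0 \<odot> b" using b V'(1) by simp
      ultimately show "v \<in> add_line V b" unfolding add_line_def by blast
    qed
  qed
  then show ?thesis using V by simp
next
  case False
  note V' = closed_subspaceD[OF V]
  obtain d where d: "0 < d" "\<And>v c. v \<in> V \<Longrightarrow> d * norm c \<le> vnorm X (v \<oplus> c \<odot> b)"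
    using line_distance[OF V b False] by blast
  have "submodule (add_line V b) scalar_space X"
  proof (rule submoduleI)
    show "add_line V b \<subseteq> carrier X" using V'(1) b by (auto simp: add_line_def)
    have "\<zero> = \<zero> \<oplus> 0 \<odot> b" using b by simp
    then show "\<zero> \<in> add_line V b" using V'(5) unfolding add_line_def by blast
    show smult: "c \<odot> x \<in> add_line V b" if x: "x \<in> add_line V b" for c x
    proof -
      from x obtain v t where "v \<in> V" "x = v \<oplus> t \<odot> b" by (auto simp: add_line_def)
      then have "c \<odot> x = c \<odot> v \<oplus> (c * t) \<odot> b" "c \<odot> v \<in> V"
        using V'(1,3) b by (simp_all add: smult_add_right)
      then show ?thesis unfolding add_line_def by blast
    qed
    show "\<ominus> x \<in> add_line V b" if "x \<in> add_line V b" for x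
    proof -
      have "x \<in> carrier X" using that V'(1) b by (auto simp: add_line_def)
      then show ?thesis using smult[OF that, of "-1"] by (simp add: a_inv_eq_smult)
    qed
    show "x \<oplus> y \<in> add_line V b" if xy: "x \<in> add_line V b" "y \<in> add_line V b" for x y
    proof -
      from xy obtain v t w s where "v \<in> V" "x = v \<oplus> t \<odot> b" "w \<in> V" "y = w \<oplus> s \<odot> b"
        by (auto simp: add_line_def)
      then have "x \<oplus> y = (v \<oplus> w) \<oplus> (t + s) \<odot> b" "v \<oplus> w \<in> V"
        using V'(1,2) b by (simp_all add: smult_add_left M.a_ac)
      then show ?thesis unfolding add_line_def by blast
    qed
  qed
  moreover have "y \<in> add_line V b"
    if y: "y \<in> carrier X" and near: "\<And>e. e > 0 \<Longrightarrow> \<exists>x\<in>add_line V b. vnorm X (y \<ominus> x) < e" for y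
  proof -
    \<comment> \<open>a sequence in the enlarged subspace that converges to \<open>y\<close>\<close>
    have "\<exists>v c. v \<in> V \<and> vnorm X (y \<ominus> (v \<oplus> c \<odot> b)) < inverse (real (Suc n))" for n
      using near[of "inverse (real (Suc n))"] by (auto simp: add_line_def)
    then obtain v c where v: "\<And>n. v n \<in> V"
      and vc: "\<And>n. vnorm X (y \<ominus> (v n \<oplus> c n \<odot> b)) < inverse (real (Suc n))"
      by metis
    have vX: "v n \<in> carrier X" for n using V'(1) v by blast
    have "Cauchy c"
    proof (rule metric_CauchyI)
      fix e :: real assume e: "0 < e"
      then obtain N where N: "inverse (real (Suc N)) < d * e / 2"
        using reals_Archimedean[of "d * e / 2"] d(1) by auto
      have "dist (c m) (c n) < e" if mn: "m \<ge> N" "n \<ge> N" for m n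
      proof -
        have small: "vnorm X (y \<ominus> (v k \<oplus> c k \<odot> b)) < d * e / 2" if "k \<ge> N" for k
        proof -
          have "inverse (real (Suc k)) \<le> inverse (real (Suc N))"
            using that by (intro le_imp_inverse_le) auto
          with vc[of k] N show ?thesis by linarith
        qed
        have "d * norm (c m - c n) \<le> vnorm X ((v m \<ominus> v n) \<oplus> (c m - c n) \<odot> b)"
          using V'(2,3) v vX by (intro d(2)) (simp add: a_minus_eq_smult)
        also have "\<dots> = vnorm X ((v m \<oplus> c m \<odot> b) \<ominus> (v n \<oplus> c n \<odot> b))"
          using vX b by (simp add: diff_add_line)
        also have "\<dots> \<le> vnorm X ((v m \<oplus> c m \<odot> b) \<ominus> y) + vnorm X (y \<ominus> (v n \<oplus> c n \<odot> b))"
          using vX b y by (intro vnorm_diff_triangle) auto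
        also have "\<dots> < d * e / 2 + d * e / 2"
          using small[OF mn(1)] small[OF mn(2)] vX b y
          by (intro add_strict_mono) (simp_all add: vnorm_diff_commute[of _ y])
        finally show ?thesis using d(1) by (simp add: dist_norm)
      qed
      then show "\<exists>M. \<forall>m\<ge>M. \<forall>n\<ge>M. dist (c m) (c n) < e" by blast
    qed
    then obtain l where l: "c \<longlonglongrightarrow> l"
      using Cauchy_convergent convergent_def by blast
    have "y \<ominus> l \<odot> b \<in> V"
    proof (rule V'(4))
      show "y \<ominus> l \<odot> b \<in> carrier X" using y b by simp
      fix e :: real assume e: "0 < e"
      have "(\<lambda>n. inverse (real (Suc n)) + norm (c n - l) * vnorm X b) \<longlonglongrightarrow> 0 + 0 * vnorm X b"
        using l by (intro tendsto_intros LIMSEQ_inverse_real_of_nat)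
          (simp add: tendsto_norm_zero_iff LIM_zero_iff)
      then have "eventually (\<lambda>n. inverse (real (Suc n)) + norm (c n - l) * vnorm X b < e) sequentially"
        using e by (intro order_tendstoD) simp
      then obtain n where n: "inverse (real (Suc n)) + norm (c n - l) * vnorm X b < e"
        by (auto simp: eventually_sequentially)
      have "(y \<ominus> l \<odot> b) \<ominus> v n = (y \<oplus> (- l) \<odot> b) \<ominus> (v n \<oplus> 0 \<odot> b)"
        using y b vX by (simp add: a_minus_eq_smult)
      also have "\<dots> = (y \<ominus> v n) \<oplus> (- c n + (c n - l)) \<odot> b"
        using y b vX by (subst diff_add_line) auto
      also have "\<dots> = (y \<ominus> v n) \<oplus> ((- c n) \<odot> b \<oplus> (c n - l) \<odot> b)"
        using b by (subst smult_add_left) auto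
      also have "\<dots> = (y \<ominus> (v n \<oplus> c n \<odot> b)) \<oplus> (c n - l) \<odot> b"
        using y b vX by (simp add: a_minus_eq_smult smult_add_right M.a_ac)
      finally have "vnorm X ((y \<ominus> l \<odot> b) \<ominus> v n)
          \<le> vnorm X (y \<ominus> (v n \<oplus> c n \<odot> b)) + norm (c n - l) * vnorm X b"
        using y b vX vnorm_triangle[of "y \<ominus> (v n \<oplus> c n \<odot> b)" "(c n - l) \<odot> b"]
        by (simp add: vnorm_smult)
      with n vc[of n] have "vnorm X ((y \<ominus> l \<odot> b) \<ominus> v n) < e" by linarith
      with v show "\<exists>v\<in>V. vnorm X (y \<ominus> l \<odot> b \<ominus> v) < e" by blast
    qed
    moreover have "y = (y \<ominus> l \<odot> b) \<oplus> l \<odot> b"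
      using y b by (simp add: a_minus_eq_smult M.a_assoc add_smult_cancel)
    ultimately show ?thesis unfolding add_line_def by blast
  qed
  ultimately show ?thesis by (auto simp: closed_subspace_def)
qed

lemma finite_span_insert:
  assumes B: "finite B" "insert b B \<subseteq> carrier X" "b \<notin> B"
  shows "finite_span (insert b B) = add_line (finite_span B) b"
proof -
  have split: "(\<Oplus>x\<in>insert b B. c x \<odot> x) = (\<Oplus>x\<in>B. c x \<odot> x) \<oplus> c b \<odot> b" for c
  proof -
    have mem: "c b \<odot> b \<in> carrier X" "(\<lambda>x. c x \<odot> x) \<in> B \<rightarrow> carrier X"
      using B(2) by auto
    then show ?thesis
      using M.finsum_insert[OF B(1,3) mem(2,1)] by (simp add: M.a_comm M.finsum_closed)
  qed
  have "(\<Oplus>x\<in>B. c x \<odot> x) \<oplus> t \<odot> b = (\<Oplus>x\<in>insert b B. (c(b := t)) x \<odot> x)" for c t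
    unfolding split using B(2,3)
    by (auto intro!: arg_cong2[where f = "(\<oplus>)"] M.finsum_cong')
  with split show ?thesis
    unfolding finite_span_def add_line_def by blast
qed

lemma closed_subspace_finite_span:
  assumes "finite B" "B \<subseteq> carrier X"
  shows "closed_subspace (finite_span B)"
  using assms
proof (induction B rule: finite_induct)
  case empty
  have "submodule {\<zero>} scalar_space X"
    by (rule submoduleI) (auto simp: a_inv_eq_smult)
  moreover have "y = \<zero>" if "y \<in> carrier X" "\<forall>e>0. vnorm X (y \<ominus> \<zero>) < e" for y
  proof -
    have "\<not> 0 < vnorm X y"
      using that by (auto simp: a_minus_eq_smult)
    then show ?thesis
      using vnorm_nonneg[OF that(1)] vnorm_eq_0_iff[OF that(1)] by simp
  qed
  ultimately show ?case
    by (auto simp: closed_subspace_def finite_span_def)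
next
  case (insert b B)
  then show ?case
    by (simp add: finite_span_insert closed_subspace_add_line)
qed

end

text \<open>
  The coordinate along \<open>b\<close> is well defined and linear because it is unique, and bounded by
  \<open>line_distance\<close>; so both summands of the algebraic splitting are operators.
\<close>

lemma operators_split_line:
  fixes X :: "('k :: {real_normed_field, banach}, 'a) normed_space"
    and Y :: "('k, 'b) normed_space"
  assumes XY: "banach_space X" "banach_space Y" and T: "T \<in> operators X Y"
    and V: "banach_space.closed_subspace Y V" and b: "b \<in> carrier Y" "b \<notin> V"
    and range: "\<And>x. x \<in> carrier X \<Longrightarrow> T x \<in> banach_space.add_line Y V b"
  obtains S f where "S \<in> operators X Y" "f \<in> operators X scalar_space"
    "\<forall>x\<in>carrier X. S x \<in> V"
    "\<forall>x\<in>carrier X. T x = S x \<oplus>\<^bsub>Y\<^esub> f x \<odot>\<^bsub>Y\<^esub> b"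
proof -
  interpret X: banach_space X by fact
  interpret Y: banach_space Y by fact
  note V' = Y.closed_subspaceD[OF V] and T' = operatorsD[OF T]
  obtain d where d: "0 < d"
    "\<And>v c. v \<in> V \<Longrightarrow> d * norm c \<le> vnorm Y (v \<oplus>\<^bsub>Y\<^esub> c \<odot>\<^bsub>Y\<^esub> b)"
    using Y.line_distance[OF V b] by blast
  have unique: "c = c'"
    if "v \<in> V" "w \<in> V" "v \<oplus>\<^bsub>Y\<^esub> c \<odot>\<^bsub>Y\<^esub> b = w \<oplus>\<^bsub>Y\<^esub> c' \<odot>\<^bsub>Y\<^esub> b" for v w c c'
  proof -
    have "d * norm (c - c') \<le> vnorm Y ((v \<ominus>\<^bsub>Y\<^esub> w) \<oplus>\<^bsub>Y\<^esub> (c - c') \<odot>\<^bsub>Y\<^esub> b)"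
      using that V'(1-3) by (intro d(2)) (simp add: Y.a_minus_eq_smult)
    also have "\<dots> = 0"
      using that(3) that(1,2) V'(1) b
      by (simp flip: Y.diff_add_line add: Y.minus_eq_zero_iff[THEN iffD2])
    finally show ?thesis using d(1) by (simp add: mult_le_0_iff)
  qed
  have "\<forall>x. \<exists>c. x \<in> carrier X \<longrightarrow> (\<exists>v\<in>V. T x = v \<oplus>\<^bsub>Y\<^esub> c \<odot>\<^bsub>Y\<^esub> b)"
    using range unfolding Y.add_line_def by blast
  then obtain g where g: "\<And>x. x \<in> carrier X \<Longrightarrow> \<exists>v\<in>V. T x = v \<oplus>\<^bsub>Y\<^esub> g x \<odot>\<^bsub>Y\<^esub> b"
    by metis
  define f where "f = restrict g (carrier X)"
  obtain M where M: "\<And>x. x \<in> carrier X \<Longrightarrow> vnorm Y (T x) \<le> M * vnorm X x"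
    using operators_bounded[OF XY T] by blast
  have f: "f \<in> operators X scalar_space"
  proof (rule operatorsI[OF XY(1) banach_space_scalar_space, where M = "M / d"])
    fix x assume x: "x \<in> carrier X"
    then obtain v where v: "v \<in> V" "T x = v \<oplus>\<^bsub>Y\<^esub> g x \<odot>\<^bsub>Y\<^esub> b" using g by blast
    then have "d * norm (g x) \<le> M * vnorm X x"
      using d(2)[OF v(1), of "g x"] M[OF x] by simp
    then show "vnorm scalar_space (f x) \<le> M / d * vnorm X x"
      using d(1) x by (simp add: f_def field_simps)
    fix c :: 'k
    obtain w where w: "w \<in> V" "T (c \<odot>\<^bsub>X\<^esub> x) = w \<oplus>\<^bsub>Y\<^esub> g (c \<odot>\<^bsub>X\<^esub> x) \<odot>\<^bsub>Y\<^esub> b"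
      using g[of "c \<odot>\<^bsub>X\<^esub> x"] x by blast
    have "g (c \<odot>\<^bsub>X\<^esub> x) = c * g x"
    proof (rule unique)
      show "w \<in> V" by (rule w)
      show "c \<odot>\<^bsub>Y\<^esub> v \<in> V" using V' v by blast
      show "w \<oplus>\<^bsub>Y\<^esub> g (c \<odot>\<^bsub>X\<^esub> x) \<odot>\<^bsub>Y\<^esub> b = c \<odot>\<^bsub>Y\<^esub> v \<oplus>\<^bsub>Y\<^esub> (c * g x) \<odot>\<^bsub>Y\<^esub> b"
        using x v V'(1) b unfolding w(2)[symmetric] by (simp add: T' Y.smult_add_right)
    qed
    then show "f (c \<odot>\<^bsub>X\<^esub> x) = c \<odot>\<^bsub>scalar_space\<^esub> f x" using x by (simp add: f_def)
  next
    fix x y assume x: "x \<in> carrier X" and y: "y \<in> carrier X"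
    obtain u where u: "u \<in> V" "T x = u \<oplus>\<^bsub>Y\<^esub> g x \<odot>\<^bsub>Y\<^esub> b" using g x by blast
    obtain v where v: "v \<in> V" "T y = v \<oplus>\<^bsub>Y\<^esub> g y \<odot>\<^bsub>Y\<^esub> b" using g y by blast
    obtain w where w: "w \<in> V" "T (x \<oplus>\<^bsub>X\<^esub> y) = w \<oplus>\<^bsub>Y\<^esub> g (x \<oplus>\<^bsub>X\<^esub> y) \<odot>\<^bsub>Y\<^esub> b"
      using g[of "x \<oplus>\<^bsub>X\<^esub> y"] x y by blast
    have "g (x \<oplus>\<^bsub>X\<^esub> y) = g x + g y"
    proof (rule unique)
      show "w \<in> V" by (rule w)
      show "u \<oplus>\<^bsub>Y\<^esub> v \<in> V" using V' u v by blast
      show "w \<oplus>\<^bsub>Y\<^esub> g (x \<oplus>\<^bsub>X\<^esub> y) \<odot>\<^bsub>Y\<^esub> b = (u \<oplus>\<^bsub>Y\<^esub> v) \<oplus>\<^bsub>Y\<^esub> (g x + g y) \<odot>\<^bsub>Y\<^esub> b"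
        using x y u v V'(1) b unfolding w(2)[symmetric]
        by (simp add: T' Y.smult_add_left Y.M.a_ac)
    qed
    then show "f (x \<oplus>\<^bsub>X\<^esub> y) = f x \<oplus>\<^bsub>scalar_space\<^esub> f y" using x y by (simp add: f_def)
  qed (simp_all add: f_def)
  have line: "(\<lambda>c\<in>carrier scalar_space. c \<odot>\<^bsub>Y\<^esub> b) \<in> operators scalar_space Y"
    by (rule operatorsI[OF banach_space_scalar_space XY(2), where M = "vnorm Y b"])
      (use b in \<open>auto simp: Y.smult_add_left Y.vnorm_smult mult.commute\<close>)
  define P where "P = (\<lambda>x\<in>carrier X. (\<lambda>c\<in>carrier scalar_space. c \<odot>\<^bsub>Y\<^esub> b) (f x))"
  define S where "S = (\<lambda>x\<in>carrier X. T x \<oplus>\<^bsub>Y\<^esub> (\<lambda>x\<in>carrier X. (-1) \<odot>\<^bsub>Y\<^esub> P x) x)"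
  have S: "S \<in> operators X Y"
    unfolding S_def P_def
    by (intro operators_add operators_smult operators_compose[OF _ banach_space_scalar_space] XY T f line)
  have S_eq: "S x = T x \<oplus>\<^bsub>Y\<^esub> (- f x) \<odot>\<^bsub>Y\<^esub> b" if "x \<in> carrier X" for x
    using that b by (simp add: S_def P_def)
  show ?thesis
  proof (rule that[OF S f]; rule ballI)
    fix x assume x: "x \<in> carrier X"
    then obtain v where v: "v \<in> V" "T x = v \<oplus>\<^bsub>Y\<^esub> f x \<odot>\<^bsub>Y\<^esub> b" using g by (auto simp: f_def)
    have "S x = v"
      using v V'(1) b x by (simp add: S_eq Y.M.a_assoc Y.add_smult_cancel)
    with v show "S x \<in> V" "T x = S x \<oplus>\<^bsub>Y\<^esub> f x \<odot>\<^bsub>Y\<^esub> b" by simp_all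
  qed
qed

text \<open>
  By induction on the size of a set generating the range: one coordinate functional is split off
  at a time, and it tends to \<open>0\<close> along \<open>x\<close> by the definition of weak convergence.
\<close>

lemma finite_rank_weakly_null:
  assumes XY: "banach_space X" "banach_space Y" and T: "finite_rank X Y T" and x: "weakly_null X x"
  shows "(\<lambda>n. vnorm Y (T (x n))) \<longlonglongrightarrow> 0"
proof -
  interpret X: banach_space X by fact
  interpret Y: banach_space Y by fact
  have xX: "x n \<in> carrier X" if "n \<ge> 1" for n
    using x that by (simp add: weakly_null_def)
  have null: "(\<lambda>n. vnorm Y (T (x n))) \<longlonglongrightarrow> 0"
    if "finite B" "B \<subseteq> carrier Y" "T \<in> operators X Y"
      "\<And>x. x \<in> carrier X \<Longrightarrow> T x \<in> Y.finite_span B" for B T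
    using that
  proof (induction B arbitrary: T rule: finite_induct)
    case empty
    have "eventually (\<lambda>n. vnorm Y (T (x n)) = 0) sequentially"
      using empty.prems(3)[OF xX]
      by (auto simp: Y.finite_span_def eventually_sequentially intro!: exI[of _ 1])
    then show ?case by (rule tendsto_eventually)
  next
    case (insert b B)
    have range: "T x \<in> Y.add_line (Y.finite_span B) b" if "x \<in> carrier X" for x
      using insert.prems(3)[OF that] Y.finite_span_insert[of B b] insert.hyps insert.prems(1) by simp
    have closed: "Y.closed_subspace (Y.finite_span B)"
      using insert by (intro Y.closed_subspace_finite_span) auto
    show ?case
    proof (cases "b \<in> Y.finite_span B")
      case True
      have "T x \<in> Y.finite_span B" if "x \<in> carrier X" for x
        using range[OF that] Y.closed_subspaceD(2,3)[OF closed] True by (auto simp: Y.add_line_def)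
      with insert show ?thesis by simp
    next
      case False
      have b: "b \<in> carrier Y" using insert.prems by simp
      obtain S f where S: "S \<in> operators X Y" and f: "f \<in> operators X scalar_space"
        and S_range: "\<forall>x\<in>carrier X. S x \<in> Y.finite_span B"
        and T_eq: "\<forall>x\<in>carrier X. T x = S x \<oplus>\<^bsub>Y\<^esub> f x \<odot>\<^bsub>Y\<^esub> b"
        by (rule operators_split_line[OF XY insert.prems(2) closed b False range]) (assumption, rule that)
      have "(\<lambda>n. f (x n)) \<longlonglongrightarrow> 0" using x f by (simp add: weakly_null_def)
      then have "(\<lambda>n. vnorm Y (S (x n)) + norm (f (x n)) * vnorm Y b) \<longlonglongrightarrow> 0 + 0 * vnorm Y b"
        using insert.IH[OF _ S] S_range insert.prems(1)
        by (intro tendsto_add tendsto_mult tendsto_norm_zero tendsto_const) simp_all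
      then have "(\<lambda>n. vnorm Y (S (x n)) + norm (f (x n)) * vnorm Y b) \<longlonglongrightarrow> 0"
        by simp
      then show ?thesis
      proof (rule tendsto_sandwich[OF _ _ tendsto_const, rotated 2])
        show "eventually (\<lambda>n. vnorm Y (T (x n)) \<le> vnorm Y (S (x n)) + norm (f (x n)) * vnorm Y b) sequentially"
          unfolding eventually_sequentially
        proof (intro exI allI impI)
          fix n :: nat assume "1 \<le> n"
          from xX[OF this] show "vnorm Y (T (x n)) \<le> vnorm Y (S (x n)) + norm (f (x n)) * vnorm Y b"
            using Y.vnorm_triangle[of "S (x n)" "f (x n) \<odot>\<^bsub>Y\<^esub> b"] operatorsD(2)[OF S] b
            by (simp add: T_eq Y.vnorm_smult)
        qed
        show "eventually (\<lambda>n. 0 \<le> vnorm Y (T (x n))) sequentially"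
          unfolding eventually_sequentially
          using xX operatorsD(2)[OF insert.prems(2)] Y.vnorm_nonneg by blast
      qed
    qed
  qed
  obtain B where B: "finite B" "B \<subseteq> carrier Y"
    and range: "\<forall>x\<in>carrier X. \<exists>c. T x = (\<Oplus>\<^bsub>Y\<^esub>b\<in>B. c b \<odot>\<^bsub>Y\<^esub> b)"
    using T by (auto simp: finite_rank_def)
  show ?thesis
  proof (rule null[OF B])
    show "T \<in> operators X Y" using T by (simp add: finite_rank_def)
    show "T x \<in> Y.finite_span B" if "x \<in> carrier X" for x
      using range that unfolding Y.finite_span_def by auto
  qed
qed

section \<open>Sequences dominated on Schreier sets\<close>

text \<open>
  Membership in the carrier is part of the notion, as sums over vectors outside the
  carrier are meaningless; the value at \<open>0\<close> is left free, since Schreier sets avoid \<open>0\<close>.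
\<close>

definition lp_dominated ::
  "(ordinal \<Rightarrow> nat \<Rightarrow> ordinal) \<Rightarrow> ereal \<Rightarrow> ordinal \<Rightarrow>
   ('k :: {real_normed_field, banach}, 'a) normed_space \<Rightarrow> real \<Rightarrow> (nat \<Rightarrow> 'a) \<Rightarrow> bool"
  where "lp_dominated z p \<xi> Y C y \<longleftrightarrow>
    (\<forall>k\<ge>1. y k \<in> carrier Y) \<and>
    (\<forall>\<alpha>\<in>schreier_coeffs z \<xi>. vnorm Y (\<Oplus>\<^bsub>Y\<^esub>k\<in>supp \<alpha>. \<alpha> k \<odot>\<^bsub>Y\<^esub> y k) \<le> C * lp_norm p \<alpha>)"

lemma schreier_coeffsD:
  assumes "\<alpha> \<in> schreier_coeffs z \<xi>"
  shows "finite (supp \<alpha>)" "supp \<alpha> \<subseteq> {1..}" "supp \<alpha> \<in> schreier z \<xi>"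
  using assms in_schreier_finite[of z \<xi> "supp \<alpha>"]
  by (auto simp: schreier_coeffs_def schreier_def)

lemma strict_mono_pos: "strict_mono r \<Longrightarrow> 1 \<le> k \<Longrightarrow> 1 \<le> r k" for r :: "nat \<Rightarrow> nat"
  using strict_mono_imp_increasing[of r k] by linarith

context banach_space
begin

lemma smult_sequence_mem:
  assumes "\<forall>k\<ge>1. y k \<in> carrier X" "\<alpha> \<in> schreier_coeffs z \<xi>"
  shows "(\<lambda>k. c k \<odot> y k) \<in> supp \<alpha> \<rightarrow> carrier X"
  using assms schreier_coeffsD(2)[OF assms(2)] by auto

lemma lp_dominated_cong:
  assumes "lp_dominated z p \<xi> X C y" "\<And>k. 1 \<le> k \<Longrightarrow> y k = y' k"
  shows "lp_dominated z p \<xi> X C y'"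
proof -
  have y: "\<forall>k\<ge>1. y k \<in> carrier X" using assms(1) by (simp add: lp_dominated_def)
  have "(\<Oplus>k\<in>supp \<alpha>. \<alpha> k \<odot> y' k) = (\<Oplus>k\<in>supp \<alpha>. \<alpha> k \<odot> y k)"
    if "\<alpha> \<in> schreier_coeffs z \<xi>" for \<alpha>
  proof (rule M.finsum_cong'[OF refl smult_sequence_mem[OF y that]])
    fix k assume "k \<in> supp \<alpha>"
    then have "1 \<le> k" using schreier_coeffsD(2)[OF that] by auto
    then show "\<alpha> k \<odot> y' k = \<alpha> k \<odot> y k" by (simp add: assms(2))
  qed
  then show ?thesis using assms by (auto simp: lp_dominated_def)
qed

lemma lp_dominated_mono:
  assumes "1 \<le> p" "C \<le> C'" "lp_dominated z p \<xi> X C y"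
  shows "lp_dominated z p \<xi> X C' y"
  unfolding lp_dominated_def
proof (intro conjI ballI)
  show "\<forall>k\<ge>1. y k \<in> carrier X" using assms(3) by (simp add: lp_dominated_def)
  fix \<alpha> :: "nat \<Rightarrow> 'k" assume \<alpha>: "\<alpha> \<in> schreier_coeffs z \<xi>"
  then have "vnorm X (\<Oplus>k\<in>supp \<alpha>. \<alpha> k \<odot> y k) \<le> C * lp_norm p \<alpha>"
    using assms(3) by (simp add: lp_dominated_def)
  also have "\<dots> \<le> C' * lp_norm p \<alpha>"
    using assms(1,2) schreier_coeffsD(1)[OF \<alpha>] by (intro mult_right_mono lp_norm_nonneg)
  finally show "vnorm X (\<Oplus>k\<in>supp \<alpha>. \<alpha> k \<odot> y k) \<le> C' * lp_norm p \<alpha>" .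
qed

text \<open>
  Coefficients for the subsequence are coefficients for the whole sequence, transported along \<open>r\<close>;
  their support is the image under \<open>r\<close>, which is a Schreier set by spreading.
\<close>

lemma lp_dominated_subsequence:
  assumes "1 \<le> p" "0 \<le> C" and r: "strict_mono r" and y: "lp_dominated z p \<xi> X C y"
  shows "lp_dominated z p \<xi> X C (\<lambda>k. y (r k))"
  unfolding lp_dominated_def
proof (intro conjI ballI)
  have mem: "\<forall>k\<ge>1. y k \<in> carrier X" using y by (simp add: lp_dominated_def)
  then show "\<forall>k\<ge>1. y (r k) \<in> carrier X" using strict_mono_pos[OF r] by simp
  fix \<alpha> :: "nat \<Rightarrow> 'k" assume \<alpha>: "\<alpha> \<in> schreier_coeffs z \<xi>"
  define \<beta> where "\<beta> j = (if j \<in> range r then \<alpha> (inv_into UNIV r j) else 0)" for j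
  have inj: "inj r" using r by (rule strict_mono_imp_inj_on)
  have \<beta>r: "\<beta> (r k) = \<alpha> k" for k by (simp add: \<beta>_def inj)
  have supp: "supp \<beta> = r ` supp \<alpha>"
    using \<beta>r by (auto simp: supp_def \<beta>_def inj dest: injD[OF inj])
  have \<beta>: "\<beta> \<in> schreier_coeffs z \<xi>"
    using \<alpha> in_schreier_spreading[OF r, of z \<xi> "supp \<alpha>"]
    by (simp add: schreier_coeffs_def schreier_def supp)
  have "(\<Oplus>k\<in>supp \<alpha>. \<alpha> k \<odot> y (r k)) = (\<Oplus>k\<in>supp \<alpha>. \<beta> (r k) \<odot> y (r k))"
    by (simp add: \<beta>r)
  also have "\<dots> = (\<Oplus>j\<in>supp \<beta>. \<beta> j \<odot> y j)"
    using smult_sequence_mem[OF mem \<beta>, of \<beta>] unfolding supp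
    by (intro M.finsum_reindex[symmetric]) (auto intro: inj_on_subset[OF inj])
  finally have "vnorm X (\<Oplus>k\<in>supp \<alpha>. \<alpha> k \<odot> y (r k)) \<le> C * lp_norm p \<beta>"
    using y \<beta> by (simp add: lp_dominated_def)
  also have "lp_norm p \<beta> \<le> 1 * lp_norm p \<alpha>"
  proof (rule lp_norm_le_of_inj[where h = "inv_into UNIV r"])
    show "inj_on (inv_into UNIV r) (supp \<beta>)" by (rule inj_onI) (auto simp: supp inj)
    show "inv_into UNIV r ` supp \<beta> \<subseteq> supp \<alpha>" by (auto simp: supp inj)
    show "norm (\<beta> k) \<le> 1 * norm (\<alpha> (inv_into UNIV r k))" if "k \<in> supp \<beta>" for k
      using that by (auto simp: \<beta>_def supp)
  qed (use assms(1) schreier_coeffsD(1)[OF \<alpha>] in simp_all)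
  finally show "vnorm X (\<Oplus>k\<in>supp \<alpha>. \<alpha> k \<odot> y (r k)) \<le> C * lp_norm p \<alpha>"
    using assms(2) by (simp add: mult_left_mono)
qed

lemma lp_dominated_add:
  assumes x: "lp_dominated z p \<xi> X C x" and y: "lp_dominated z p \<xi> X D y"
  shows "lp_dominated z p \<xi> X (C + D) (\<lambda>k. x k \<oplus> y k)"
  unfolding lp_dominated_def
proof (intro conjI ballI)
  have mem: "\<forall>k\<ge>1. x k \<in> carrier X" "\<forall>k\<ge>1. y k \<in> carrier X"
    using x y by (simp_all add: lp_dominated_def)
  then show "\<forall>k\<ge>1. x k \<oplus> y k \<in> carrier X" by simp
  fix \<alpha> :: "nat \<Rightarrow> 'k" assume \<alpha>: "\<alpha> \<in> schreier_coeffs z \<xi>"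
  note mem' = smult_sequence_mem[OF mem(1) \<alpha>, of \<alpha>] smult_sequence_mem[OF mem(2) \<alpha>, of \<alpha>]
  have "(\<Oplus>k\<in>supp \<alpha>. \<alpha> k \<odot> (x k \<oplus> y k)) = (\<Oplus>k\<in>supp \<alpha>. \<alpha> k \<odot> x k \<oplus> \<alpha> k \<odot> y k)"
    using mem' mem schreier_coeffsD(2)[OF \<alpha>]
    by (intro M.finsum_cong') (auto simp: smult_add_right)
  also have "\<dots> = (\<Oplus>k\<in>supp \<alpha>. \<alpha> k \<odot> x k) \<oplus> (\<Oplus>k\<in>supp \<alpha>. \<alpha> k \<odot> y k)"
    by (rule M.finsum_addf[OF mem'])
  finally have "vnorm X (\<Oplus>k\<in>supp \<alpha>. \<alpha> k \<odot> (x k \<oplus> y k))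
      \<le> vnorm X (\<Oplus>k\<in>supp \<alpha>. \<alpha> k \<odot> x k) + vnorm X (\<Oplus>k\<in>supp \<alpha>. \<alpha> k \<odot> y k)"
    using mem' by (simp add: vnorm_triangle M.finsum_closed)
  also have "\<dots> \<le> (C + D) * lp_norm p \<alpha>"
    using x y \<alpha> unfolding lp_dominated_def distrib_right by (intro add_mono) auto
  finally show "vnorm X (\<Oplus>k\<in>supp \<alpha>. \<alpha> k \<odot> (x k \<oplus> y k)) \<le> (C + D) * lp_norm p \<alpha>" .
qed

text \<open>
  The factors are moved into the coefficients. They have to be nonzero for the support to stay
  the same Schreier set.
\<close>

lemma lp_dominated_rescale:
  assumes "1 \<le> p" "0 \<le> C" and y: "lp_dominated z p \<xi> X C y"
    and t: "\<And>k. 1 \<le> k \<Longrightarrow> 0 < t k \<and> t k \<le> K"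
  shows "lp_dominated z p \<xi> X (C * K) (\<lambda>k. of_real (t k) \<odot> y k)"
  unfolding lp_dominated_def
proof (intro conjI ballI)
  have mem: "\<forall>k\<ge>1. y k \<in> carrier X" using y by (simp add: lp_dominated_def)
  then show "\<forall>k\<ge>1. of_real (t k) \<odot> y k \<in> carrier X" by simp
  have K: "0 \<le> K" using t[of 1] by simp
  fix \<alpha> :: "nat \<Rightarrow> 'k" assume \<alpha>: "\<alpha> \<in> schreier_coeffs z \<xi>"
  note supp_\<alpha> = schreier_coeffsD(2)[OF \<alpha>]
  define \<beta> :: "nat \<Rightarrow> 'k" where "\<beta> k = \<alpha> k * of_real (t k)" for k
  have "\<alpha> k * of_real (t k) \<noteq> 0" if "\<alpha> k \<noteq> 0" for k
    using that supp_\<alpha> t[of k] by (auto simp: supp_def)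
  then have supp: "supp \<beta> = supp \<alpha>" by (auto simp: supp_def \<beta>_def)
  then have \<beta>: "\<beta> \<in> schreier_coeffs z \<xi>" using \<alpha> by (simp add: schreier_coeffs_def)
  have "(\<Oplus>k\<in>supp \<alpha>. \<alpha> k \<odot> (of_real (t k) \<odot> y k)) = (\<Oplus>k\<in>supp \<beta>. \<beta> k \<odot> y k)"
    unfolding supp using smult_sequence_mem[OF mem \<alpha>, of \<beta>] mem supp_\<alpha>
    by (intro M.finsum_cong') (auto simp: \<beta>_def)
  then have "vnorm X (\<Oplus>k\<in>supp \<alpha>. \<alpha> k \<odot> (of_real (t k) \<odot> y k)) \<le> C * lp_norm p \<beta>"
    using y \<beta> by (simp add: lp_dominated_def)
  also have "lp_norm p \<beta> \<le> K * lp_norm p \<alpha>"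
  proof (rule lp_norm_le_of_inj[where h = id])
    fix k assume "k \<in> supp \<beta>"
    then have "1 \<le> k" using supp supp_\<alpha> by auto
    from t[OF this] show "norm (\<beta> k) \<le> K * norm (\<alpha> (id k))"
      by (simp add: \<beta>_def norm_mult mult.commute[of "norm (\<alpha> k)"] mult_right_mono)
  qed (use assms(1) K supp schreier_coeffsD(1)[OF \<alpha>] in simp_all)
  finally show "vnorm X (\<Oplus>k\<in>supp \<alpha>. \<alpha> k \<odot> (of_real (t k) \<odot> y k)) \<le> (C * K) * lp_norm p \<alpha>"
    using assms(2) by (simp add: mult_left_mono mult.assoc)
qed

text \<open>
  The constant is \<open>2 = (\<Sum>k. (1 / 2) ^ k)\<close>, each coefficient being at most the \<open>\<ell>\<^sub>p\<close>-norm.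
\<close>

lemma lp_dominated_summable:
  assumes p: "1 \<le> p" and mem: "\<forall>k\<ge>1. y k \<in> carrier X"
    and small: "\<And>k. 1 \<le> k \<Longrightarrow> vnorm X (y k) \<le> (1 / 2) ^ k"
  shows "lp_dominated z p \<xi> X 2 y"
  unfolding lp_dominated_def
proof (intro conjI ballI mem)
  fix \<alpha> :: "nat \<Rightarrow> 'k" assume \<alpha>: "\<alpha> \<in> schreier_coeffs z \<xi>"
  note supp = schreier_coeffsD(1,2)[OF \<alpha>]
  have "vnorm X (\<Oplus>k\<in>supp \<alpha>. \<alpha> k \<odot> y k) \<le> (\<Sum>k\<in>supp \<alpha>. vnorm X (\<alpha> k \<odot> y k))"
    by (rule vnorm_finsum_le[OF supp(1) smult_sequence_mem[OF mem \<alpha>]])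
  also have "\<dots> \<le> (\<Sum>k\<in>supp \<alpha>. lp_norm p \<alpha> * (1 / 2) ^ k)"
  proof (rule sum_mono)
    fix k assume "k \<in> supp \<alpha>"
    then have k: "1 \<le> k" using supp(2) by auto
    then have "vnorm X (\<alpha> k \<odot> y k) = norm (\<alpha> k) * vnorm X (y k)"
      using mem by (simp add: vnorm_smult)
    also have "\<dots> \<le> lp_norm p \<alpha> * (1 / 2) ^ k"
      using k mem by (intro mult_mono norm_le_lp_norm p supp small lp_norm_nonneg vnorm_nonneg) auto
    finally show "vnorm X (\<alpha> k \<odot> y k) \<le> lp_norm p \<alpha> * (1 / 2) ^ k" .
  qed
  also have "\<dots> = lp_norm p \<alpha> * (\<Sum>k\<in>supp \<alpha>. (1 / 2) ^ k)"
    by (simp add: sum_distrib_left)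
  also have "(\<Sum>k\<in>supp \<alpha>. (1 / 2) ^ k) \<le> (\<Sum>k. (1 / 2 :: real) ^ k)"
    by (intro sum_le_suminf summable_geometric supp) auto
  also have "(\<Sum>k. (1 / 2 :: real) ^ k) = 2"
    by (subst suminf_geometric) auto
  finally show "vnorm X (\<Oplus>k\<in>supp \<alpha>. \<alpha> k \<odot> y k) \<le> 2 * lp_norm p \<alpha>"
    using lp_norm_nonneg[OF p supp(1)] by (simp add: mult_left_mono)
qed

lemma lp_dominated_null_subsequence:
  fixes y :: "nat \<Rightarrow> 'a"
  assumes p: "1 \<le> p" and mem: "\<forall>k\<ge>1. y k \<in> carrier X"
    and null: "\<And>e N. 0 < e \<Longrightarrow> \<exists>n>N. vnorm X (y n) < e"
  obtains r where "strict_mono r" "lp_dominated z p \<xi> X 2 (\<lambda>k. y (r k))"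
proof -
  have "\<exists>r. \<forall>k. (1 \<le> r k \<and> vnorm X (y (r k)) < (1 / 2) ^ k) \<and> r k < r (Suc k)"
  proof (rule dependent_nat_choice)
    show "\<exists>n. 1 \<le> n \<and> vnorm X (y n) < (1 / 2) ^ 0"
      using null[of 1 0] by (auto simp: Suc_le_eq)
    show "\<exists>m. (1 \<le> m \<and> vnorm X (y m) < (1 / 2) ^ Suc k) \<and> n < m" for n k
    proof -
      obtain m where "n < m" "vnorm X (y m) < (1 / 2) ^ Suc k"
        using null[of "(1 / 2) ^ Suc k" n] by auto
      then show ?thesis by (intro exI[of _ m]) auto
    qed
  qed
  then obtain r where r: "\<And>k. vnorm X (y (r k)) < (1 / 2) ^ k" "\<And>k. r k < r (Suc k)" by blast
  have "strict_mono r" using r(2) by (simp add: strict_mono_Suc_iff)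
  moreover have "lp_dominated z p \<xi> X 2 (\<lambda>k. y (r k))"
    using mem strict_mono_pos[OF \<open>strict_mono r\<close>] r(1)
    by (intro lp_dominated_summable[OF p]) (auto intro: less_imp_le)
  ultimately show ?thesis by (rule that)
qed

end

lemma lp_dominated_operator:
  fixes Y :: "('k :: {real_normed_field, banach}, 'a) normed_space" and Z :: "('k, 'b) normed_space"
  assumes YZ: "banach_space Y" "banach_space Z" and B: "B \<in> operators Y Z"
    and M: "0 \<le> M" "\<And>y. y \<in> carrier Y \<Longrightarrow> vnorm Z (B y) \<le> M * vnorm Y y"
    and y: "lp_dominated z p \<xi> Y C y"
  shows "lp_dominated z p \<xi> Z (M * C) (\<lambda>k. B (y k))"
  unfolding lp_dominated_def
proof (intro conjI ballI)
  interpret Y: banach_space Y by fact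
  interpret Z: banach_space Z by fact
  note B' = operatorsD[OF B]
  have mem: "\<forall>k\<ge>1. y k \<in> carrier Y" using y by (simp add: lp_dominated_def)
  then show mem': "\<forall>k\<ge>1. B (y k) \<in> carrier Z" using B'(2) by blast
  fix \<alpha> :: "nat \<Rightarrow> 'k" assume \<alpha>: "\<alpha> \<in> schreier_coeffs z \<xi>"
  have "(\<Oplus>\<^bsub>Z\<^esub>k\<in>supp \<alpha>. \<alpha> k \<odot>\<^bsub>Z\<^esub> B (y k)) = (\<Oplus>\<^bsub>Z\<^esub>k\<in>supp \<alpha>. B (\<alpha> k \<odot>\<^bsub>Y\<^esub> y k))"
    using mem mem' schreier_coeffsD(2)[OF \<alpha>] by (intro Z.M.finsum_cong') (auto simp: B'(4))
  also have "\<dots> = B (\<Oplus>\<^bsub>Y\<^esub>k\<in>supp \<alpha>. \<alpha> k \<odot>\<^bsub>Y\<^esub> y k)"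
    by (rule operators_finsum[OF YZ B schreier_coeffsD(1)[OF \<alpha>]
          Y.smult_sequence_mem[OF mem \<alpha>], symmetric])
  finally have "vnorm Z (\<Oplus>\<^bsub>Z\<^esub>k\<in>supp \<alpha>. \<alpha> k \<odot>\<^bsub>Z\<^esub> B (y k))
      \<le> M * vnorm Y (\<Oplus>\<^bsub>Y\<^esub>k\<in>supp \<alpha>. \<alpha> k \<odot>\<^bsub>Y\<^esub> y k)"
    using M(2) Y.smult_sequence_mem[OF mem \<alpha>] by (simp add: Y.M.finsum_closed)
  also have "\<dots> \<le> M * (C * lp_norm p \<alpha>)"
    using y \<alpha> M(1) by (intro mult_left_mono) (simp_all add: lp_dominated_def)
  finally show "vnorm Z (\<Oplus>\<^bsub>Z\<^esub>k\<in>supp \<alpha>. \<alpha> k \<odot>\<^bsub>Z\<^esub> B (y k)) \<le> M * C * lp_norm p \<alpha>"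
    by (simp add: mult.assoc)
qed

section \<open>The ideal properties\<close>

lemma normalized_subsequence:
  "strict_mono r \<Longrightarrow> normalized X x \<Longrightarrow> normalized X (\<lambda>k. x (r k))"
  using strict_mono_pos[of r] by (simp add: normalized_def)

lemma weakly_null_subsequence:
  assumes "strict_mono r" "weakly_null X x"
  shows "weakly_null X (\<lambda>k. x (r k))"
  unfolding weakly_null_def
proof (intro conjI ballI)
  show "\<forall>k\<ge>1. x (r k) \<in> carrier X"
    using assms strict_mono_pos[of r] by (simp add: weakly_null_def)
  show "(\<lambda>k. f (x (r k))) \<longlonglongrightarrow> 0" if "f \<in> operators X scalar_space" for f
    using assms that LIMSEQ_subseq_LIMSEQ[of "\<lambda>n. f (x n)" 0 r]
    by (simp add: weakly_null_def o_def)
qed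

text \<open>
  A witness for \<open>C\<close> in the definition is used with \<open>\<epsilon> = 1\<close> and yields the uniform constant \<open>C + 1\<close>.
\<close>

lemma WD_infinity_iff:
  assumes "1 \<le> p" "banach_space Y"
  shows "T \<in> WD_infinity z p \<xi> X Y \<longleftrightarrow> T \<in> operators X Y \<and>
    (\<exists>C\<ge>0. \<forall>x. normalized X x \<longrightarrow> weakly_null X x \<longrightarrow>
       (\<exists>r. strict_mono r \<and> lp_dominated z p \<xi> Y C (\<lambda>k. T (x (r k)))))"
    (is "_ \<longleftrightarrow> _ \<and> ?R")
proof -
  interpret Y: banach_space Y by fact
  have mem: "T (x (r k)) \<in> carrier Y"
    if "T \<in> operators X Y" "normalized X x" "strict_mono r" "1 \<le> k" for x and r :: "nat \<Rightarrow> nat" and k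
    using that strict_mono_pos[OF that(3,4)] operatorsD(2)[OF that(1)] by (simp add: normalized_def)
  show ?thesis
  proof
    assume "T \<in> WD_infinity z p \<xi> X Y"
    then obtain C where C: "0 \<le> C" "T \<in> WD z p C \<xi> X Y" by (auto simp: WD_infinity_def)
    then have T: "T \<in> operators X Y" by (simp add: WD_def)
    have "\<exists>r. strict_mono r \<and> lp_dominated z p \<xi> Y (C + 1) (\<lambda>k. T (x (r k)))"
      if x: "normalized X x" "weakly_null X x" for x
    proof -
      obtain r where r: "strict_mono r" "\<forall>\<alpha>\<in>schreier_coeffs z \<xi>.
          vnorm Y (\<Oplus>\<^bsub>Y\<^esub>k\<in>supp \<alpha>. \<alpha> k \<odot>\<^bsub>Y\<^esub> T (x (r k))) \<le> (C + 1) * lp_norm p \<alpha>"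
        using C(2)[unfolded WD_def, THEN CollectD, THEN conjunct2, rule_format, of 1 x] x by auto
      with mem[OF T x(1) r(1)] show ?thesis unfolding lp_dominated_def by blast
    qed
    with C(1) T show "T \<in> operators X Y \<and> ?R"
      by (intro conjI exI[of _ "C + 1"]) auto
  next
    assume R: "T \<in> operators X Y \<and> ?R"
    then obtain C where C: "0 \<le> C" "\<And>x. normalized X x \<Longrightarrow> weakly_null X x \<Longrightarrow>
       \<exists>r. strict_mono r \<and> lp_dominated z p \<xi> Y C (\<lambda>k. T (x (r k)))" by blast
    have "\<exists>r. strict_mono r \<and> lp_dominated z p \<xi> Y (C + \<epsilon>) (\<lambda>k. T (x (r k)))"
      if "0 < \<epsilon>" "normalized X x" "weakly_null X x" for \<epsilon> x
      using C(2)[OF that(2,3)] Y.lp_dominated_mono[OF assms(1), of C "C + \<epsilon>"] that(1) by force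
    then have "T \<in> WD z p C \<xi> X Y"
      using R by (simp add: WD_def lp_dominated_def) blast
    with C(1) show "T \<in> WD_infinity z p \<xi> X Y" by (auto simp: WD_infinity_def)
  qed
qed

lemma WD_infinity_add:
  assumes p: "1 \<le> p" and XY: "banach_space X" "banach_space Y"
    and S: "S \<in> WD_infinity z p \<xi> X Y" and T: "T \<in> WD_infinity z p \<xi> X Y"
  shows "(\<lambda>x\<in>carrier X. S x \<oplus>\<^bsub>Y\<^esub> T x) \<in> WD_infinity z p \<xi> X Y"
proof -
  interpret Y: banach_space Y by fact
  obtain C where S': "S \<in> operators X Y" "0 \<le> C"
    "\<And>x. normalized X x \<Longrightarrow> weakly_null X x \<Longrightarrow>
       \<exists>r. strict_mono r \<and> lp_dominated z p \<xi> Y C (\<lambda>k. S (x (r k)))"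
    using S unfolding WD_infinity_iff[OF p XY(2)] by blast
  obtain D where T': "T \<in> operators X Y" "0 \<le> D"
    "\<And>x. normalized X x \<Longrightarrow> weakly_null X x \<Longrightarrow>
       \<exists>r. strict_mono r \<and> lp_dominated z p \<xi> Y D (\<lambda>k. T (x (r k)))"
    using T unfolding WD_infinity_iff[OF p XY(2)] by blast
  show ?thesis
    unfolding WD_infinity_iff[OF p XY(2)]
  proof (intro conjI operators_add XY S' T' exI[of _ "C + D"] allI impI)
    show "0 \<le> C + D" using S'(2) T'(2) by simp
    fix x assume x: "normalized X x" "weakly_null X x"
    obtain r where r: "strict_mono r" "lp_dominated z p \<xi> Y C (\<lambda>k. S (x (r k)))"
      using S'(3)[OF x] by blast
    obtain s where s: "strict_mono s" "lp_dominated z p \<xi> Y D (\<lambda>k. T (x (r (s k))))"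
      using T'(3)[OF normalized_subsequence[OF r(1) x(1)] weakly_null_subsequence[OF r(1) x(2)]]
      by blast
    have rs: "strict_mono (\<lambda>k. r (s k))" using r(1) s(1) by (simp add: strict_mono_def)
    have "lp_dominated z p \<xi> Y (C + D) (\<lambda>k. S (x (r (s k))) \<oplus>\<^bsub>Y\<^esub> T (x (r (s k))))"
      by (rule Y.lp_dominated_add[OF Y.lp_dominated_subsequence[OF p S'(2) s(1) r(2)] s(2)])
    moreover have mem: "x (r (s k)) \<in> carrier X" if "1 \<le> k" for k
      using normalized_subsequence[OF rs x(1)] that by (simp add: normalized_def)
    ultimately have "lp_dominated z p \<xi> Y (C + D)
        (\<lambda>k. (\<lambda>x\<in>carrier X. S x \<oplus>\<^bsub>Y\<^esub> T x) (x (r (s k))))"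
      by (elim Y.lp_dominated_cong) (simp only: mem restrict_apply')
    with rs show "\<exists>r. strict_mono r \<and> lp_dominated z p \<xi> Y (C + D)
        (\<lambda>k. (\<lambda>x\<in>carrier X. S x \<oplus>\<^bsub>Y\<^esub> T x) (x (r k)))"
      by blast
  qed
qed

lemma WD_infinity_compose_left:
  assumes p: "1 \<le> p" and XYZ: "banach_space X" "banach_space Y" "banach_space Z"
    and T: "T \<in> WD_infinity z p \<xi> X Y" and B: "B \<in> operators Y Z"
  shows "(\<lambda>x\<in>carrier X. B (T x)) \<in> WD_infinity z p \<xi> X Z"
proof -
  interpret Z: banach_space Z by fact
  obtain C where T': "T \<in> operators X Y" "0 \<le> C"
    "\<And>x. normalized X x \<Longrightarrow> weakly_null X x \<Longrightarrow>
       \<exists>r. strict_mono r \<and> lp_dominated z p \<xi> Y C (\<lambda>k. T (x (r k)))"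
    using T unfolding WD_infinity_iff[OF p XYZ(2)] by blast
  obtain M where M: "0 \<le> M" "\<And>y. y \<in> carrier Y \<Longrightarrow> vnorm Z (B y) \<le> M * vnorm Y y"
    using operators_bounded[OF XYZ(2,3) B] by blast
  show ?thesis
    unfolding WD_infinity_iff[OF p XYZ(3)]
  proof (intro conjI operators_compose[OF XYZ] T' B exI[of _ "M * C"] allI impI)
    show "0 \<le> M * C" using M(1) T'(2) by simp
    fix x assume x: "normalized X x" "weakly_null X x"
    obtain r where r: "strict_mono r" "lp_dominated z p \<xi> Y C (\<lambda>k. T (x (r k)))"
      using T'(3)[OF x] by blast
    have mem: "x (r k) \<in> carrier X" if "1 \<le> k" for k
      using normalized_subsequence[OF r(1) x(1)] that by (simp add: normalized_def)
    have "B (T (x (r k))) = (\<lambda>x\<in>carrier X. B (T x)) (x (r k))" if "1 \<le> k" for k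
      using mem[OF that] by simp
    then have "lp_dominated z p \<xi> Z (M * C) (\<lambda>k. (\<lambda>x\<in>carrier X. B (T x)) (x (r k)))"
      by (intro Z.lp_dominated_cong[OF lp_dominated_operator[OF XYZ(2,3) B M r(2)]]) simp
    with r(1) show "\<exists>r. strict_mono r \<and>
        lp_dominated z p \<xi> Z (M * C) (\<lambda>k. (\<lambda>x\<in>carrier X. B (T x)) (x (r k)))"
      by blast
  qed
qed

text \<open>Multiplication by a scalar is composition with a homothety of \<open>Y\<close>.\<close>

lemma WD_infinity_smult:
  assumes p: "1 \<le> p" and XY: "banach_space X" "banach_space Y"
    and T: "T \<in> WD_infinity z p \<xi> X Y"
  shows "(\<lambda>x\<in>carrier X. c \<odot>\<^bsub>Y\<^esub> T x) \<in> WD_infinity z p \<xi> X Y"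
proof -
  interpret Y: banach_space Y by fact
  have T': "T \<in> operators X Y" using T unfolding WD_infinity_iff[OF p XY(2)] by blast
  have "(\<lambda>y\<in>carrier Y. c \<odot>\<^bsub>Y\<^esub> y) \<in> operators Y Y"
    by (rule operatorsI[OF XY(2) XY(2), where M = "norm c"])
      (auto simp: Y.smult_add_right Y.vnorm_smult mult.commute)
  from WD_infinity_compose_left[OF p XY XY(2) T this]
  have "(\<lambda>x\<in>carrier X. (\<lambda>y\<in>carrier Y. c \<odot>\<^bsub>Y\<^esub> y) (T x)) \<in> WD_infinity z p \<xi> X Y" .
  also have "(\<lambda>x\<in>carrier X. (\<lambda>y\<in>carrier Y. c \<odot>\<^bsub>Y\<^esub> y) (T x)) = (\<lambda>x\<in>carrier X. c \<odot>\<^bsub>Y\<^esub> T x)"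
    using operatorsD(2)[OF T'] by (intro restrict_ext) simp
  finally show ?thesis .
qed

lemma WD_infinity_finite_rank:
  assumes p: "1 \<le> p" and XY: "banach_space X" "banach_space Y" and T: "finite_rank X Y T"
  shows "T \<in> WD_infinity z p \<xi> X Y"
  unfolding WD_infinity_iff[OF p XY(2)]
proof (intro conjI exI[of _ 2] allI impI)
  interpret Y: banach_space Y by fact
  show T': "T \<in> operators X Y" using T by (simp add: finite_rank_def)
  fix x assume x: "normalized X x" "weakly_null X x"
  have null: "\<exists>n>N. vnorm Y (T (x n)) < e" if e: "0 < e" for e N
  proof -
    obtain n where "\<forall>m\<ge>n. vnorm Y (T (x m)) < e"
      using order_tendstoD(2)[OF finite_rank_weakly_null[OF XY T x(2)] e]
      unfolding eventually_sequentially by blast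
    then show ?thesis by (intro exI[of _ "max n (Suc N)"]) simp
  qed
  have mem: "\<forall>k\<ge>1. T (x k) \<in> carrier Y"
    using x(1) operatorsD(2)[OF T'] by (simp add: normalized_def)
  obtain r where "strict_mono r" "lp_dominated z p \<xi> Y 2 (\<lambda>k. T (x (r k)))"
    by (rule Y.lp_dominated_null_subsequence[OF p mem null])
  then show "\<exists>r. strict_mono r \<and> lp_dominated z p \<xi> Y 2 (\<lambda>k. T (x (r k)))" by blast
qed simp

text \<open>
  The sequence \<open>A w\<close> may fail to be normalized in two ways. If its norms come arbitrarily close to \<open>0\<close>
  infinitely often, then so do those of \<open>T (A w)\<close>, and a summable subsequence is dominated with constant \<open>2\<close>.
  Otherwise a tail \<open>A u\<close> can be normalized, which costs the factor \<open>K\<close>, a bound of \<open>A\<close>. The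
  constant \<open>C * K + 2\<close> covers both cases, so it does not depend on \<open>w\<close>.
\<close>

lemma WD_infinity_compose_right:
  fixes W :: "('k :: {real_normed_field, banach}, 'a) normed_space"
    and X :: "('k, 'b) normed_space" and Y :: "('k, 'c) normed_space"
  assumes p: "1 \<le> p" and WXY: "banach_space W" "banach_space X" "banach_space Y"
    and A: "A \<in> operators W X" and T: "T \<in> WD_infinity z p \<xi> X Y"
  shows "(\<lambda>w\<in>carrier W. T (A w)) \<in> WD_infinity z p \<xi> W Y"
proof -
  interpret X: banach_space X by fact
  interpret Y: banach_space Y by fact
  obtain C where T': "T \<in> operators X Y" "0 \<le> C"
    "\<And>x. normalized X x \<Longrightarrow> weakly_null X x \<Longrightarrow>
       \<exists>r. strict_mono r \<and> lp_dominated z p \<xi> Y C (\<lambda>k. T (x (r k)))"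
    using T unfolding WD_infinity_iff[OF p WXY(3)] by blast
  obtain K where K: "0 \<le> K" "\<And>w. w \<in> carrier W \<Longrightarrow> vnorm X (A w) \<le> K * vnorm W w"
    using operators_bounded[OF WXY(1,2) A] by blast
  obtain M where M: "0 \<le> M" "\<And>x. x \<in> carrier X \<Longrightarrow> vnorm Y (T x) \<le> M * vnorm X x"
    using operators_bounded[OF WXY(2,3) T'(1)] by blast
  note A' = operatorsD[OF A] and TD = operatorsD[OF T'(1)]
  have dominated: "\<exists>r. strict_mono r \<and> lp_dominated z p \<xi> Y (C * K + 2) (\<lambda>k. T (A (w (r k))))"
    if w: "normalized W w" "weakly_null W w" for w
  proof (cases "\<forall>e>0. \<forall>N. \<exists>n>N. vnorm X (A (w n)) < e")
    case True
    have wW: "w n \<in> carrier W" if "1 \<le> n" for n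
      using w(1) that by (simp add: normalized_def)
    have null: "\<exists>n>N. vnorm Y (T (A (w n))) < e" if e: "0 < e" for e N
    proof -
      obtain n where n: "n > N" "vnorm X (A (w n)) < e / (M + 1)"
        using True e M(1) by (meson add_nonneg_pos divide_pos_pos zero_less_one)
      have "vnorm Y (T (A (w n))) \<le> M * vnorm X (A (w n))"
        using n(1) wW[of n] by (intro M A') auto
      also have "\<dots> \<le> (M + 1) * vnorm X (A (w n))"
        using n(1) wW[of n] by (intro mult_right_mono X.vnorm_nonneg A') auto
      also have "\<dots> < e" using n(2) M(1) by (simp add: field_simps)
      finally show ?thesis using n(1) by blast
    qed
    have mem: "\<forall>k\<ge>1. T (A (w k)) \<in> carrier Y" using wW A'(2) TD(2) by blast
    obtain r where r: "strict_mono r" "lp_dominated z p \<xi> Y 2 (\<lambda>k. T (A (w (r k))))"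
      by (rule Y.lp_dominated_null_subsequence[OF p mem null]) (assumption, rule that)
    have "2 \<le> C * K + 2" using T'(2) K(1) by simp
    from Y.lp_dominated_mono[OF p this r(2)] r(1) show ?thesis by blast
  next
    case False
    then obtain d N where "0 < d" "\<forall>n>N. \<not> vnorm X (A (w n)) < d" by blast
    then have d: "0 < d" "\<And>n. n > N \<Longrightarrow> d \<le> vnorm X (A (w n))" by auto
    have shift: "strict_mono (\<lambda>n. n + N)" by (simp add: strict_mono_def)
    define u where "u n = w (n + N)" for n
    have u: "normalized W u" "weakly_null W u"
      using normalized_subsequence[OF shift w(1)] weakly_null_subsequence[OF shift w(2)]
      by (simp_all add: u_def[abs_def])
    have uW: "u n \<in> carrier W" "vnorm W (u n) = 1" if "1 \<le> n" for n
      using u(1) that by (simp_all add: normalized_def)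
    define t where "t n = vnorm X (A (u n))" for n
    have t: "d \<le> t n" "t n \<le> K" if "1 \<le> n" for n
      using d(2)[of "n + N"] K(2)[OF uW(1)[OF that]] uW(2)[OF that] that
      by (simp_all add: t_def u_def)
    define x where "x n = (of_real (inverse (t n)) :: 'k) \<odot>\<^bsub>X\<^esub> A (u n)" for n
    have x: "normalized X x"
      unfolding normalized_def
    proof (intro allI impI)
      fix n :: nat assume n: "1 \<le> n"
      have "0 < t n" using t(1)[OF n] d(1) by simp
      then show "x n \<in> carrier X \<and> vnorm X (x n) = 1"
        using A'(2)[OF uW(1)[OF n]] by (simp add: x_def X.vnorm_smult norm_inverse t_def[symmetric])
    qed
    \<comment> \<open>Normalization preserves weak nullity because its factors are at most \<open>1 / d\<close>.\<close>
    have "weakly_null X x"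
      unfolding weakly_null_def
    proof (intro conjI ballI)
      show "\<forall>n\<ge>1. x n \<in> carrier X" using x by (simp add: normalized_def)
      fix f assume f: "f \<in> operators X scalar_space"
      have "(\<lambda>w\<in>carrier W. f (A w)) \<in> operators W scalar_space"
        by (rule operators_compose[OF WXY(1,2) banach_space_scalar_space A f])
      then have "(\<lambda>n. (\<lambda>w\<in>carrier W. f (A w)) (u n)) \<longlonglongrightarrow> 0"
        using u(2) unfolding weakly_null_def by blast
      then have "(\<lambda>n. inverse d * norm ((\<lambda>w\<in>carrier W. f (A w)) (u n))) \<longlonglongrightarrow> 0"
        by (intro tendsto_mult_right_zero tendsto_norm_zero)
      then show "(\<lambda>n. f (x n)) \<longlonglongrightarrow> 0"
      proof (rule Lim_null_comparison[rotated])
        show "\<forall>\<^sub>F n in sequentially.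
            norm (f (x n)) \<le> inverse d * norm ((\<lambda>w\<in>carrier W. f (A w)) (u n))"
          unfolding eventually_sequentially
        proof (intro exI allI impI)
          fix n :: nat assume n: "1 \<le> n"
          have "norm (f (x n)) = inverse (t n) * norm (f (A (u n)))"
            using t(1)[OF n] d(1) A'(2)[OF uW(1)[OF n]] operatorsD(4)[OF f]
            by (simp add: x_def norm_mult norm_inverse)
          also have "\<dots> \<le> inverse d * norm (f (A (u n)))"
            using t(1)[OF n] d(1) by (intro mult_right_mono le_imp_inverse_le) auto
          finally show "norm (f (x n)) \<le> inverse d * norm ((\<lambda>w\<in>carrier W. f (A w)) (u n))"
            using uW(1)[OF n] by simp
        qed
      qed
    qed
    from T'(3)[OF x this] obtain r
      where r: "strict_mono r" "lp_dominated z p \<xi> Y C (\<lambda>k. T (x (r k)))" by blast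
    have "0 < t (r k) \<and> t (r k) \<le> K" if "1 \<le> k" for k
      using t[OF strict_mono_pos[OF r(1) that]] d(1) by simp
    from Y.lp_dominated_rescale[OF p T'(2) r(2) this]
    have "lp_dominated z p \<xi> Y (C * K) (\<lambda>k. of_real (t (r k)) \<odot>\<^bsub>Y\<^esub> T (x (r k)))" .
    then have "lp_dominated z p \<xi> Y (C * K) (\<lambda>k. T (A (w (r k + N))))"
    proof (rule Y.lp_dominated_cong)
      fix k :: nat assume "1 \<le> k"
      note rk = strict_mono_pos[OF r(1) this]
      have "t (r k) \<noteq> 0" using t(1)[OF rk] d(1) by simp
      moreover have "A (u (r k)) \<in> carrier X" by (rule A'(2)[OF uW(1)[OF rk]])
      ultimately have "of_real (t (r k)) \<odot>\<^bsub>X\<^esub> x (r k) = A (u (r k))"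
        by (simp add: x_def flip: of_real_mult)
      moreover have "x (r k) \<in> carrier X" using x rk by (simp add: normalized_def)
      ultimately show "of_real (t (r k)) \<odot>\<^bsub>Y\<^esub> T (x (r k)) = T (A (w (r k + N)))"
        using TD(4)[of "x (r k)" "of_real (t (r k))"] by (simp add: u_def)
    qed
    then have "lp_dominated z p \<xi> Y (C * K + 2) (\<lambda>k. T (A (w (r k + N))))"
      by (rule Y.lp_dominated_mono[OF p, rotated]) simp
    moreover have "strict_mono (\<lambda>k. r k + N)" using r(1) by (simp add: strict_mono_def)
    ultimately show ?thesis by blast
  qed
  have *: "\<exists>r. strict_mono r \<and>
      lp_dominated z p \<xi> Y (C * K + 2) (\<lambda>k. (\<lambda>w\<in>carrier W. T (A w)) (w (r k)))"
    if w: "normalized W w" "weakly_null W w" for w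
  proof -
    obtain r where r: "strict_mono r" "lp_dominated z p \<xi> Y (C * K + 2) (\<lambda>k. T (A (w (r k))))"
      using dominated[OF w] by blast
    have mem: "w (r k) \<in> carrier W" if "1 \<le> k" for k
      using normalized_subsequence[OF r(1) w(1)] that by (simp add: normalized_def)
    have "lp_dominated z p \<xi> Y (C * K + 2) (\<lambda>k. (\<lambda>w\<in>carrier W. T (A w)) (w (r k)))"
      by (intro Y.lp_dominated_cong[OF r(2)]) (simp only: mem restrict_apply')
    with r(1) show ?thesis by blast
  qed
  have "0 \<le> C * K + 2" using T'(2) K(1) by simp
  with * show ?thesis
    unfolding WD_infinity_iff[OF p WXY(3)]
    using operators_compose[OF WXY A T'(1)] by blast
qed

theorem mainTheorem5:
  fixes z :: "ordinal \<Rightarrow> nat \<Rightarrow> ordinal" and p :: ereal and \<xi> :: ordinal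
  assumes "limit_choice z"
    and "1 \<le> p"
    and "1 \<le> \<xi>" and "\<xi> \<le> omega1"
  shows "operator_ideal
    (WD_infinity z p \<xi> ::
      ('k :: {real_normed_field, banach}, 'a) normed_space \<Rightarrow>
      ('k, 'a) normed_space \<Rightarrow> ('a \<Rightarrow> 'a) set)"
  unfolding operator_ideal_def
proof (intro conjI allI impI ballI; (elim conjE)?)
  fix X Y :: "('k, 'a) normed_space"
  assume XY: "banach_space X" "banach_space Y"
  interpret X: banach_space X by fact
  interpret Y: banach_space Y by fact
  show "WD_infinity z p \<xi> X Y \<subseteq> operators X Y"
    by (auto simp: WD_infinity_iff[OF assms(2) XY(2)])
  have "(\<lambda>x\<in>carrier X. \<zero>\<^bsub>Y\<^esub>) \<in> operators X Y"
    by (rule operatorsI[OF XY, where M = 0]) auto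
  then have "finite_rank X Y (\<lambda>x\<in>carrier X. \<zero>\<^bsub>Y\<^esub>)"
    by (auto simp: finite_rank_def intro!: exI[of _ "{}"])
  then show "(\<lambda>x\<in>carrier X. \<zero>\<^bsub>Y\<^esub>) \<in> WD_infinity z p \<xi> X Y"
    by (rule WD_infinity_finite_rank[OF assms(2) XY])
  show "(\<lambda>x\<in>carrier X. S x \<oplus>\<^bsub>Y\<^esub> T x) \<in> WD_infinity z p \<xi> X Y"
    if "S \<in> WD_infinity z p \<xi> X Y" "T \<in> WD_infinity z p \<xi> X Y" for S T
    by (rule WD_infinity_add[OF assms(2) XY that])
  show "(\<lambda>x\<in>carrier X. c \<odot>\<^bsub>Y\<^esub> T x) \<in> WD_infinity z p \<xi> X Y"
    if "T \<in> WD_infinity z p \<xi> X Y" for c T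
    by (rule WD_infinity_smult[OF assms(2) XY that])
  show "T \<in> WD_infinity z p \<xi> X Y" if "finite_rank X Y T" for T
    by (rule WD_infinity_finite_rank[OF assms(2) XY that])
next
  fix W X Y Z :: "('k, 'a) normed_space" and T A B
  assume bs: "banach_space W" "banach_space X" "banach_space Y" "banach_space Z"
    and T: "T \<in> WD_infinity z p \<xi> X Y" and A: "A \<in> operators W X" and B: "B \<in> operators Y Z"
  have "(\<lambda>w\<in>carrier W. B ((\<lambda>w\<in>carrier W. T (A w)) w)) \<in> WD_infinity z p \<xi> W Z"
    by (rule WD_infinity_compose_left[OF assms(2) bs(1,3,4)
          WD_infinity_compose_right[OF assms(2) bs(1-3) A T] B])
  also have "(\<lambda>w\<in>carrier W. B ((\<lambda>w\<in>carrier W. T (A w)) w)) = (\<lambda>w\<in>carrier W. B (T (A w)))"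
    by (rule restrict_ext) simp
  finally show "(\<lambda>w\<in>carrier W. B (T (A w))) \<in> WD_infinity z p \<xi> W Z" .
qed

end
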